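(* Let $n\ge3$ and let $\phi:\mathbb{R}\to\mathbb{R}$ be a bounded $C^2$ function which has bounded first and second derivatives. Then there exists $\lambda>0$ large enough such that the $n$-dimensional manifold $\mathbb{R}\times S^{n-1}$ with the metric $g=dt^2+e^{\frac{2\phi(t)}{n-1}}g_{S^{n-1}_\lambda}$ and the function $f=\phi(t)$ is $CD(0,1)$, where $S^{n-1}_\lambda$ is the round $(n-1)$-sphere of constant Ricci curvature $\lambda$.
   Context: For an $n$-dimensional Riemannian manifold $(M,g)$ and a function $f:M\to\mathbb{R}$, put $$\mathrm{Ric}_f^1=\mathrm{Ric}+\mathrm{Hess} f+\frac{df\otimes df}{n-1}.$$ $(M,g,f)$ is $CD(0,1)$ if $\mathrm{Ric}_f^1\ge 0$ (this makes sense for $C^2$ metrics and $C^2$ functions). That $S^{n-1}_\lambda$ has constant Ricci curvature $\lambda$ means $\mathrm{Ric}=\lambda\, g_{S^{n-1}_\lambda}$. *)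

theory Defs
  imports "HOL-Analysis.Analysis"
begin

text \<open>
  Manifolds are embedded submanifolds of a Euclidean space, so that tangent vectors are vectors of
  the ambient space.  Tensors are evaluated in all smooth local parametrizations, by the usual
  coordinate formulas.
\<close>

text \<open>For open \<open>U\<close>, this is k-fold continuous differentiability on \<open>U\<close>: all iterated directional
  derivatives up to order \<open>k\<close> along basis vectors exist and are continuous.\<close>

primrec Ck_on :: "nat \<Rightarrow> ('a::euclidean_space \<Rightarrow> 'b::real_normed_vector) \<Rightarrow> 'a set \<Rightarrow> bool" where
  "Ck_on 0 f U \<longleftrightarrow> continuous_on U f"
| "Ck_on (Suc k) f U \<longleftrightarrow>
     (\<forall>x\<in>U. f differentiable (at x)) \<and>
     (\<forall>b\<in>Basis. Ck_on k (\<lambda>x. frechet_derivative f (at x) b) U)"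

definition smooth_on :: "('a::euclidean_space \<Rightarrow> 'b::real_normed_vector) \<Rightarrow> 'a set \<Rightarrow> bool" where
  "smooth_on f U \<longleftrightarrow> (\<forall>k. Ck_on k f U)"

definition partial :: "'k::finite \<Rightarrow> (real ^ 'k \<Rightarrow> 'b::real_normed_vector) \<Rightarrow> real ^ 'k \<Rightarrow> 'b" where
  "partial i f u = frechet_derivative f (at u) (axis i 1)"

subsection \<open>Embedded submanifolds and Riemannian metrics\<close>

definition local_param ::
  "'v::euclidean_space set \<Rightarrow> (real ^ 'k::finite) set \<Rightarrow> (real ^ 'k \<Rightarrow> 'v) \<Rightarrow> bool" where
  "local_param M U F \<longleftrightarrow>
     open U \<and> smooth_on F U \<and> (\<forall>u\<in>U. inj (frechet_derivative F (at u))) \<and>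
     openin (top_of_set M) (F ` U) \<and> (\<exists>G. homeomorphism U (F ` U) F G)"

text \<open>The dimension of the manifold is \<open>CARD('k)\<close>.\<close>

definition submanifold :: "'k::finite itself \<Rightarrow> 'v::euclidean_space set \<Rightarrow> bool" where
  "submanifold (_::'k itself) M \<longleftrightarrow>
     (\<forall>p\<in>M. \<exists>U (F :: real ^ 'k \<Rightarrow> 'v). local_param M U F \<and> p \<in> F ` U)"

definition metric_coeffs ::
  "('v::euclidean_space \<Rightarrow> 'v \<Rightarrow> 'v \<Rightarrow> real) \<Rightarrow> (real ^ 'k::finite \<Rightarrow> 'v) \<Rightarrow> real ^ 'k \<Rightarrow> real ^ 'k ^ 'k"
where
  "metric_coeffs g F u = (\<chi> i j. g (F u) (partial i F u) (partial j F u))"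

text \<open>A metric assigns to \<open>p \<in> M\<close> a bilinear form \<open>g p\<close> on the ambient space, of which only the
  restriction to the tangent space of \<open>M\<close> at \<open>p\<close> matters; that restriction has to be an inner
  product, and of class \<open>C\<^sup>2\<close> in \<open>p\<close>.\<close>

definition riemannian_manifold ::
  "'k::finite itself \<Rightarrow> 'v::euclidean_space set \<Rightarrow> ('v \<Rightarrow> 'v \<Rightarrow> 'v \<Rightarrow> real) \<Rightarrow> bool" where
  "riemannian_manifold (K::'k itself) M g \<longleftrightarrow>
     submanifold K M \<and> (\<forall>p\<in>M. bilinear (g p)) \<and>
     (\<forall>U (F :: real ^ 'k \<Rightarrow> 'v). local_param M U F \<longrightarrow>
        (\<forall>i j. Ck_on 2 (\<lambda>u. metric_coeffs g F u $ i $ j) U) \<and>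
        (\<forall>u\<in>U. transpose (metric_coeffs g F u) = metric_coeffs g F u \<and>
           (\<forall>v. v \<noteq> 0 \<longrightarrow> v \<bullet> (metric_coeffs g F u *v v) > 0)))"

subsection \<open>Curvature and Hessian in coordinates\<close>

text \<open>Here \<open>G\<close> is the matrix of metric coefficients as a function of the coordinates;
  \<open>christoffel G k i j\<close> has upper index \<open>k\<close>.  The sign of the Ricci tensor is the one for which
  round spheres have positive Ricci curvature.\<close>

definition christoffel ::
  "(real ^ 'k \<Rightarrow> real ^ 'k ^ 'k) \<Rightarrow> 'k::finite \<Rightarrow> 'k \<Rightarrow> 'k \<Rightarrow> real ^ 'k \<Rightarrow> real" where
  "christoffel G k i j u =
     (1 / 2) * (\<Sum>l\<in>UNIV. matrix_inv (G u) $ k $ l *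
       (partial i (\<lambda>x. G x $ j $ l) u + partial j (\<lambda>x. G x $ i $ l) u
        - partial l (\<lambda>x. G x $ i $ j) u))"

definition ricci ::
  "(real ^ 'k \<Rightarrow> real ^ 'k ^ 'k) \<Rightarrow> 'k::finite \<Rightarrow> 'k \<Rightarrow> real ^ 'k \<Rightarrow> real" where
  "ricci G i j u =
     (\<Sum>k\<in>UNIV. partial k (christoffel G k i j) u - partial j (christoffel G k i k) u) +
     (\<Sum>k\<in>UNIV. \<Sum>l\<in>UNIV. christoffel G k k l u * christoffel G l i j u
                        - christoffel G k j l u * christoffel G l i k u)"

definition hess ::
  "(real ^ 'k \<Rightarrow> real ^ 'k ^ 'k) \<Rightarrow> (real ^ 'k \<Rightarrow> real) \<Rightarrow> 'k::finite \<Rightarrow> 'k \<Rightarrow> real ^ 'k \<Rightarrow> real" where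
  "hess G f i j u =
     partial i (partial j f) u - (\<Sum>k\<in>UNIV. christoffel G k i j u * partial k f u)"

definition ric1 ::
  "(real ^ 'k \<Rightarrow> real ^ 'k ^ 'k) \<Rightarrow> (real ^ 'k \<Rightarrow> real) \<Rightarrow> 'k::finite \<Rightarrow> 'k \<Rightarrow> real ^ 'k \<Rightarrow> real" where
  "ric1 G f i j u =
     ricci G i j u + hess G f i j u + partial i f u * partial j f u / (real CARD('k) - 1)"

definition constant_ricci ::
  "'k::finite itself \<Rightarrow> 'v::euclidean_space set \<Rightarrow> ('v \<Rightarrow> 'v \<Rightarrow> 'v \<Rightarrow> real) \<Rightarrow> real \<Rightarrow> bool" where
  "constant_ricci (K::'k itself) M g c \<longleftrightarrow>
     riemannian_manifold K M g \<and>
     (\<forall>U (F :: real ^ 'k \<Rightarrow> 'v). local_param M U F \<longrightarrow>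
        (\<forall>u\<in>U. \<forall>i j. ricci (metric_coeffs g F) i j u = c * metric_coeffs g F u $ i $ j))"

definition CD01 ::
  "'k::finite itself \<Rightarrow> 'v::euclidean_space set \<Rightarrow> ('v \<Rightarrow> 'v \<Rightarrow> 'v \<Rightarrow> real) \<Rightarrow> ('v \<Rightarrow> real) \<Rightarrow> bool"
where
  "CD01 (K::'k itself) M g f \<longleftrightarrow>
     riemannian_manifold K M g \<and>
     (\<forall>U (F :: real ^ 'k \<Rightarrow> 'v). local_param M U F \<longrightarrow>
        Ck_on 2 (f \<circ> F) U \<and>
        (\<forall>u\<in>U. \<forall>v. (\<Sum>i\<in>UNIV. \<Sum>j\<in>UNIV.
            ric1 (metric_coeffs g F) (f \<circ> F) i j u * v $ i * v $ j) \<ge> 0))"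

subsection \<open>The round metric and warped products over the line\<close>

definition induced_metric :: "'v::euclidean_space \<Rightarrow> 'v \<Rightarrow> 'v \<Rightarrow> real" where
  "induced_metric p v w = v \<bullet> w"

text \<open>The metric \<open>dt\<^sup>2 + h(t) g\<close> on the product of the line with the manifold carrying \<open>g\<close>.\<close>

definition warped_metric ::
  "(real \<Rightarrow> real) \<Rightarrow> ('v::euclidean_space \<Rightarrow> 'v \<Rightarrow> 'v \<Rightarrow> real) \<Rightarrow>
   real \<times> 'v \<Rightarrow> real \<times> 'v \<Rightarrow> real \<times> 'v \<Rightarrow> real" where
  "warped_metric h g p a b = fst a * fst b + h (fst p) * g (snd p) (snd a) (snd b)"

end

theory Submission imports Defs begin

text \<open>
  In a parametrization \<open>(T, X)\<close> of the warped product, with \<open>h\<^sub>i\<^sub>j = X\<^sub>i \<bullet> X\<^sub>j\<close> and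
  \<open>\<psi> = exp (\<phi> / (n - 1))\<close>, the metric is \<open>E\<^sub>i \<bullet> E\<^sub>j\<close> for the frame \<open>E\<^sub>i = (T\<^sub>i, \<psi>(T) X\<^sub>i)\<close> of the
  orthogonal complement of \<open>(0, X)\<close> in \<open>\<real> \<times> \<real>\<^sup>n\<close>. An explicit skew-symmetric connection on
  \<open>\<real> \<times> \<real>\<^sup>n\<close> preserves this complement and has no torsion on the frame, so its coefficients are the
  Christoffel symbols and its curvature, which is an algebraic expression in \<open>T\<^sub>i\<close> and \<open>X\<^sub>i\<close>, gives
  the Ricci tensor by taking a trace. In \<open>Ric + Hess f + df \<otimes> df / (n - 1)\<close> the coefficient of
  \<open>T\<^sub>i T\<^sub>j\<close> cancels, and the coefficient of \<open>h\<^sub>i\<^sub>j\<close> is \<open>(n - 2) / r\<^sup>2 - \<psi>\<^sup>2 \<phi>'' / (n - 1)\<close>, which is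
  nonnegative once the radius \<open>r\<close> is small. The sphere is the case \<open>T = 0\<close>, \<open>\<psi> = 1\<close>.
\<close>

section \<open>Calculus of \<open>C\<^sup>k\<close> functions\<close>

lemma Ck_on_Suc_differentiable: "Ck_on (Suc k) f U \<Longrightarrow> x \<in> U \<Longrightarrow> f differentiable (at x)"
  by simp

lemma has_derivative_frechet:
  "f differentiable (at x) \<Longrightarrow> (f has_derivative frechet_derivative f (at x)) (at x)"
  by (simp add: frechet_derivative_works)

lemma Ck_on_has_derivative:
  "Ck_on (Suc k) f U \<Longrightarrow> x \<in> U \<Longrightarrow> (f has_derivative frechet_derivative f (at x)) (at x)"
  by (simp add: frechet_derivative_works)

lemma Ck_on_SucD: "Ck_on (Suc k) f U \<Longrightarrow> Ck_on k f U"
proof (induction k arbitrary: f)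
  case 0
  then show ?case
    by (simp add: differentiable_imp_continuous_on differentiable_on_def differentiable_at_withinI)
qed auto

lemma Ck_on_mono: "Ck_on l f U \<Longrightarrow> k \<le> l \<Longrightarrow> Ck_on k f U"
  by (induction l) (auto simp del: Ck_on.simps(2) dest: Ck_on_SucD simp: le_Suc_eq)

lemma smooth_on_imp_Ck: "smooth_on f U \<Longrightarrow> Ck_on k f U"
  by (simp add: smooth_on_def)

text \<open>Equality on an open set is equality near each of its points, so the derivatives agree
  there as well and the induction can be repeated on them.\<close>

lemma Ck_on_cong:
  assumes "open U" "\<And>x. x \<in> U \<Longrightarrow> f x = g x" "Ck_on k f U"
  shows "Ck_on k g U"
  using assms(2,3)
proof (induction k arbitrary: f g)
  case 0
  then show ?case using continuous_on_cong by force
next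
  case (Suc k)
  have "g differentiable (at x)" if "x \<in> U" for x
    using has_derivative_transform_within_open[OF Ck_on_has_derivative[OF Suc.prems(2) that]
        assms(1) that, of g] Suc.prems(1) by (auto simp: differentiable_def)
  moreover have "Ck_on k (\<lambda>x. frechet_derivative g (at x) b) U" if "b \<in> Basis" for b
  proof (rule Suc.IH)
    show "frechet_derivative f (at x) b = frechet_derivative g (at x) b" if "x \<in> U" for x
      using frechet_derivative_transform_within_open[OF Ck_on_Suc_differentiable[OF Suc.prems(2) that]
          assms(1) that Suc.prems(1)] by simp
    show "Ck_on k (\<lambda>x. frechet_derivative f (at x) b) U"
      using Suc.prems(2) that by simp
  qed
  ultimately show ?case by simp
qed

text \<open>Lets the inductions below work with an explicit derivative instead of
  \<open>frechet_derivative\<close>.\<close>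

lemma Ck_on_SucI:
  assumes "open U" "\<And>x. x \<in> U \<Longrightarrow> (f has_derivative f' x) (at x)"
    and "\<And>b. b \<in> Basis \<Longrightarrow> Ck_on k (\<lambda>x. f' x b) U"
  shows "Ck_on (Suc k) f U"
  using assms(2) frechet_derivative_at[OF assms(2)]
  by (auto simp: differentiable_def intro!: Ck_on_cong[OF assms(1) _ assms(3)])

lemma Ck_on_const [intro]: "Ck_on k (\<lambda>x. c) U"
  by (induction k arbitrary: c) auto

lemma Ck_on_bounded_linear:
  assumes "open U" "bounded_linear h" "Ck_on k f U"
  shows "Ck_on k (\<lambda>x. h (f x)) U"
  using assms(3)
proof (induction k arbitrary: f)
  case 0
  then show ?case using assms(2) by (simp add: bounded_linear.continuous_on)
next
  case (Suc k)
  show ?case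
  proof (rule Ck_on_SucI[OF assms(1)])
    show "((\<lambda>x. h (f x)) has_derivative (\<lambda>v. h (frechet_derivative f (at x) v))) (at x)"
      if "x \<in> U" for x
      using bounded_linear.has_derivative[OF assms(2) Ck_on_has_derivative[OF Suc.prems that]] .
  qed (use Suc in simp_all)
qed

lemma Ck_on_add:
  assumes "open U" "Ck_on k f U" "Ck_on k g U"
  shows "Ck_on k (\<lambda>x. f x + g x) U"
  using assms(2,3)
proof (induction k arbitrary: f g)
  case 0
  then show ?case by (simp add: continuous_on_add)
next
  case (Suc k)
  show ?case
    by (rule Ck_on_SucI[OF assms(1) has_derivative_add[OF Ck_on_has_derivative[OF Suc.prems(1)]
          Ck_on_has_derivative[OF Suc.prems(2)]]])
      (use Suc in simp_all)
qed

lemma Ck_on_bilinear: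
  assumes "open U" "bounded_bilinear h" "Ck_on k f U" "Ck_on k g U"
  shows "Ck_on k (\<lambda>x. h (f x) (g x)) U"
  using assms(3,4)
proof (induction k arbitrary: f g)
  case 0
  then show ?case using bounded_bilinear.continuous_on[OF assms(2)] by simp
next
  case (Suc k)
  show ?case
  proof (rule Ck_on_SucI[OF assms(1) bounded_bilinear.FDERIV[OF assms(2)
          Ck_on_has_derivative[OF Suc.prems(1)] Ck_on_has_derivative[OF Suc.prems(2)]]])
    \<comment> \<open>Each term of the product rule pairs a derivative with an undifferentiated
      factor, so the induction hypothesis also needs \<open>f\<close> and \<open>g\<close>
      themselves at level \<open>k\<close>.\<close>
    fix b :: 'a assume "b \<in> Basis"
    then show "Ck_on k (\<lambda>x. h (f x) (frechet_derivative g (at x) b)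
        + h (frechet_derivative f (at x) b) (g x)) U"
      using Suc.prems Suc.prems[THEN Ck_on_SucD] by (intro Ck_on_add assms(1) Suc.IH) simp_all
  qed (use Suc in simp_all)
qed

lemmas Ck_on_inner = Ck_on_bilinear[OF _ bounded_bilinear_inner]
lemmas Ck_on_scaleR = Ck_on_bilinear[OF _ bounded_bilinear_scaleR]
lemmas Ck_on_mult = Ck_on_bilinear[OF _ bounded_bilinear_mult]

lemma Ck_on_Pair:
  fixes f :: "'a::euclidean_space \<Rightarrow> 'b::real_normed_vector" and g :: "'a \<Rightarrow> 'c::real_normed_vector"
  assumes "open U" "Ck_on k f U" "Ck_on k g U"
  shows "Ck_on k (\<lambda>x. (f x, g x)) U"
proof -
  have "Ck_on k (\<lambda>x. (f x, 0) + (0, g x)) U"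
    using assms
    by (intro Ck_on_add Ck_on_bounded_linear[of U "\<lambda>x. (x, 0)"] Ck_on_bounded_linear[of U "\<lambda>x. (0, x)"]
        bounded_linear_Pair bounded_linear_ident bounded_linear_zero)
  then show ?thesis by simp
qed

text \<open>By the chain rule the derivative is the product of that of \<open>T\<close> and
  \<open>h'\<close> composed with \<open>T\<close>; the induction therefore varies \<open>h\<close>
  and keeps \<open>T\<close> fixed.\<close>

lemma Ck_on_compose_real:
  fixes T :: "'a::euclidean_space \<Rightarrow> real" and h :: "real \<Rightarrow> 'b::real_normed_vector"
  assumes "open U" "Ck_on k h UNIV" "Ck_on k T U"
  shows "Ck_on k (\<lambda>x. h (T x)) U"
  using assms(2,3)
proof (induction k arbitrary: h)
  case 0
  then show ?case using continuous_on_compose2[of UNIV h U T] by simp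
next
  case (Suc k)
  have h: "frechet_derivative h (at y) s = s *\<^sub>R frechet_derivative h (at y) 1" for y s
    using linear_cmul[OF linear_frechet_derivative, of h "at y" s 1] Suc.prems(1) by simp
  show ?case
  proof (rule Ck_on_SucI[OF assms(1)])
    show "((\<lambda>x. h (T x)) has_derivative (\<lambda>v. frechet_derivative T (at x) v *\<^sub>R
        frechet_derivative h (at (T x)) 1)) (at x)" if "x \<in> U" for x
      using diff_chain_at[OF Ck_on_has_derivative[OF Suc.prems(2) that]
          Ck_on_has_derivative[OF Suc.prems(1)], OF UNIV_I]
      unfolding o_def by (rule has_derivative_eq_rhs) (rule ext, rule h)
    show "Ck_on k (\<lambda>x. frechet_derivative T (at x) b *\<^sub>R frechet_derivative h (at (T x)) 1) U"
      if "b \<in> Basis" for b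
      using Suc.prems that by (intro Ck_on_scaleR assms(1) Suc.IH Ck_on_SucD[of k T]) simp_all
  qed
qed

lemma Ck_on_exp: "Ck_on k (exp :: real \<Rightarrow> real) UNIV"
proof (induction k)
  case (Suc k)
  show ?case
  proof (rule Ck_on_SucI[OF open_UNIV])
    show "(exp has_derivative (\<lambda>s. exp x * s)) (at x)" for x :: real
      using DERIV_exp[of x] unfolding has_field_derivative_def .
    show "Ck_on k (\<lambda>x::real. exp x * b) UNIV" if "b \<in> Basis" for b
      using Suc.IH that by simp
  qed
qed (simp add: continuous_on_exp continuous_on_id)

text \<open>With \<open>w = inverse (sqrt g)\<close> one has \<open>dw = - (1/2) * w^3 * dg\<close>,
  a polynomial in \<open>w\<close> and \<open>dg\<close>, so the induction closes on itself.\<close>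

lemma Ck_on_inverse_sqrt:
  fixes g :: "'a::euclidean_space \<Rightarrow> real"
  assumes "open U" "Ck_on k g U" "\<And>x. x \<in> U \<Longrightarrow> g x > 0"
  shows "Ck_on k (\<lambda>x. inverse (sqrt (g x))) U"
  using assms(2)
proof (induction k)
  case 0
  have "g x \<noteq> 0" if "x \<in> U" for x
    using assms(3)[OF that] by simp
  with 0 show ?case by (simp add: continuous_on_inverse continuous_on_real_sqrt)
next
  case (Suc k)
  define w where "w = (\<lambda>x. inverse (sqrt (g x)))"
  have w: "Ck_on k w U" unfolding w_def by (rule Suc.IH[OF Ck_on_SucD[OF Suc.prems]])
  show ?case unfolding w_def[symmetric]
  proof (rule Ck_on_SucI[OF assms(1)])
    show "(w has_derivative (\<lambda>v. - (1/2) * ((w x * w x * w x) * frechet_derivative g (at x) v))) (at x)"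
      if "x \<in> U" for x
    proof -
      have "((\<lambda>y. inverse (sqrt y)) has_real_derivative - (1/2) * (w x * w x * w x)) (at (g x))"
        using assms(3)[OF that] unfolding w_def
        by (auto intro!: derivative_eq_intros simp: field_simps)
      from diff_chain_at[OF Ck_on_has_derivative[OF Suc.prems that] this[unfolded has_field_derivative_def]]
      show ?thesis unfolding w_def o_def by (rule has_derivative_eq_rhs) (simp add: fun_eq_iff)
    qed
    show "Ck_on k (\<lambda>x. - (1/2) * ((w x * w x * w x) * frechet_derivative g (at x) b)) U" if "b \<in> Basis" for b
      using Suc.prems that by (intro Ck_on_mult w assms(1) Ck_on_const) simp
  qed
qed

section \<open>Partial derivatives\<close>

lemma partial_eq: "(f has_derivative f') (at u) \<Longrightarrow> partial i f u = f' (axis i 1)"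
  unfolding partial_def using frechet_derivative_at by metis

lemma partial_const [simp]: "partial i (\<lambda>x. c) = (\<lambda>u. 0)"
  by (simp add: fun_eq_iff partial_def)

lemma Ck_on_partial: "Ck_on (Suc k) f U \<Longrightarrow> Ck_on k (partial i f) U"
  unfolding partial_def[abs_def] by (auto simp: axis_in_Basis_iff)

lemma partial_cong:
  "open U \<Longrightarrow> u \<in> U \<Longrightarrow> f differentiable (at u) \<Longrightarrow> (\<And>x. x \<in> U \<Longrightarrow> f x = g x) \<Longrightarrow>
    partial i f u = partial i g u"
  unfolding partial_def by (metis frechet_derivative_transform_within_open)

lemma differentiable_cong_open:
  "f differentiable (at u) \<Longrightarrow> open U \<Longrightarrow> u \<in> U \<Longrightarrow> (\<And>x. x \<in> U \<Longrightarrow> f x = g x) \<Longrightarrow>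
    g differentiable (at u)"
  by (rule differentiableI[OF has_derivative_transform_within_open[OF has_derivative_frechet]])

lemma partial_bounded_linear:
  "bounded_linear h \<Longrightarrow> f differentiable (at u) \<Longrightarrow>
    partial i (\<lambda>x. h (f x)) u = h (partial i f u)"
  unfolding partial_def[of i f]
  by (rule partial_eq[OF bounded_linear.has_derivative[OF _ has_derivative_frechet]])

lemma partial_bilinear:
  "bounded_bilinear h \<Longrightarrow> f differentiable (at u) \<Longrightarrow> g differentiable (at u) \<Longrightarrow>
    partial i (\<lambda>x. h (f x) (g x)) u = h (f u) (partial i g u) + h (partial i f u) (g u)"
  unfolding partial_def[of i f] partial_def[of i g]
  by (rule partial_eq[OF bounded_bilinear.FDERIV[OF _ has_derivative_frechet has_derivative_frechet]])

lemmas partial_inner = partial_bilinear[OF bounded_bilinear_inner]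
lemmas partial_scaleR = partial_bilinear[OF bounded_bilinear_scaleR]
lemmas partial_mult = partial_bilinear[OF bounded_bilinear_mult]

lemma partial_add:
  "f differentiable (at u) \<Longrightarrow> g differentiable (at u) \<Longrightarrow>
    partial i (\<lambda>x. f x + g x) u = partial i f u + partial i g u"
  unfolding partial_def[of i f] partial_def[of i g]
  by (rule partial_eq[OF has_derivative_add[OF has_derivative_frechet has_derivative_frechet]])

lemma partial_diff:
  "f differentiable (at u) \<Longrightarrow> g differentiable (at u) \<Longrightarrow>
    partial i (\<lambda>x. f x - g x) u = partial i f u - partial i g u"
  unfolding partial_def[of i f] partial_def[of i g]
  by (rule partial_eq[OF has_derivative_diff[OF has_derivative_frechet has_derivative_frechet]])

lemma partial_sum:
  "finite A \<Longrightarrow> (\<And>a. a \<in> A \<Longrightarrow> f a differentiable (at u)) \<Longrightarrow>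
    partial i (\<lambda>x. \<Sum>a\<in>A. f a x) u = (\<Sum>a\<in>A. partial i (f a) u)"
  by (induction A rule: finite_induct) (simp_all add: partial_add)

lemma partial_Pair:
  "f differentiable (at u) \<Longrightarrow> g differentiable (at u) \<Longrightarrow>
    partial i (\<lambda>x. (f x, g x)) u = (partial i f u, partial i g u)"
  unfolding partial_def[of i f] partial_def[of i g]
  by (rule partial_eq[OF has_derivative_Pair[OF has_derivative_frechet has_derivative_frechet]])

lemma has_derivative_compose_real:
  "(h has_real_derivative h') (at (T u)) \<Longrightarrow> T differentiable (at u) \<Longrightarrow>
    ((\<lambda>x. h (T x)) has_derivative (\<lambda>v. h' * frechet_derivative T (at u) v)) (at u)"
  using diff_chain_at[OF has_derivative_frechet, of T u h] by (auto simp: has_field_derivative_def o_def)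

lemma partial_compose_real:
  "(h has_real_derivative h') (at (T u)) \<Longrightarrow> T differentiable (at u) \<Longrightarrow>
    partial i (\<lambda>x. h (T x)) u = h' * partial i T u"
  unfolding partial_def[of i T] by (rule partial_eq[OF has_derivative_compose_real])

lemma differentiable_compose_real:
  fixes h :: "real \<Rightarrow> real"
  shows "(h has_real_derivative h') (at (T u)) \<Longrightarrow> T differentiable (at u) \<Longrightarrow>
    (\<lambda>x. h (T x)) differentiable (at u)"
  using has_derivative_compose_real unfolding differentiable_def by blast

lemma differential_eq_sum_partial:
  fixes F :: "real ^ 'k::finite \<Rightarrow> 'v::real_normed_vector"
  assumes "F differentiable (at u)"
  shows "frechet_derivative F (at u) v = (\<Sum>i\<in>UNIV. v $ i *\<^sub>R partial i F u)"
proof -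
  note lin = linear_frechet_derivative[OF assms]
  have "v = (\<Sum>i\<in>UNIV. v $ i *\<^sub>R axis i 1)"
    by (simp add: basis_expansion scalar_mult_eq_scaleR[symmetric])
  from arg_cong[OF this, of "frechet_derivative F (at u)"] show ?thesis
    by (simp add: partial_def linear_sum[OF lin] linear_cmul[OF lin])
qed

text \<open>Schwarz's theorem, by applying the mean value theorem twice to a second difference.\<close>

lemma second_difference:
  fixes f :: "'a::euclidean_space \<Rightarrow> real"
  assumes f: "Ck_on 2 f U" and h: "0 < h" and ab: "a \<in> Basis" "b \<in> Basis"
    and U: "\<And>s t. 0 \<le> s \<Longrightarrow> s \<le> h \<Longrightarrow> 0 \<le> t \<Longrightarrow> t \<le> h \<Longrightarrow> u + s *\<^sub>R a + t *\<^sub>R b \<in> U"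
  obtains s t where "0 < s" "s < h" "0 < t" "t < h"
    "f (u + h *\<^sub>R a + h *\<^sub>R b) - f (u + h *\<^sub>R a) - f (u + h *\<^sub>R b) + f u =
      h * h * frechet_derivative (\<lambda>x. frechet_derivative f (at x) a) (at (u + s *\<^sub>R a + t *\<^sub>R b)) b"
proof -
  define fa where "fa = (\<lambda>x. frechet_derivative f (at x) a)"
  have D: "((\<lambda>s. g (p + s *\<^sub>R c)) has_real_derivative frechet_derivative g (at (p + s *\<^sub>R c)) c) (at s)"
    if "g differentiable (at (p + s *\<^sub>R c))" for g :: "'a \<Rightarrow> real" and p c s
  proof -
    have "((\<lambda>s. p + s *\<^sub>R c) has_derivative (\<lambda>s. s *\<^sub>R c)) (at s)"
      by (auto intro!: derivative_eq_intros)
    from diff_chain_at[OF this has_derivative_frechet[OF that]]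
    show ?thesis unfolding has_field_derivative_def o_def
      by (rule has_derivative_eq_rhs)
        (simp add: fun_eq_iff linear_cmul[OF linear_frechet_derivative[OF that]])
  qed
  have f1: "f differentiable (at x)" "fa differentiable (at x)" if "x \<in> U" for x
    using f that ab by (auto simp: numeral_2_eq_2 fa_def)
  \<comment> \<open>The second difference is the increment along \<open>a\<close> of the difference
    of \<open>f\<close> between two parallel segments offset by
    \<open>h *\<^sub>R b\<close>.\<close>
  have "\<exists>s>0. s < h \<and> (f ((u + h *\<^sub>R b) + h *\<^sub>R a) - f (u + h *\<^sub>R a)) -
        (f ((u + h *\<^sub>R b) + 0 *\<^sub>R a) - f (u + 0 *\<^sub>R a)) = (h - 0) * (fa ((u + h *\<^sub>R b) + s *\<^sub>R a) - fa (u + s *\<^sub>R a))"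
    using h U[of _ 0] U[of _ h] unfolding fa_def
    by (intro MVT2[of 0 h "\<lambda>s. f ((u + h *\<^sub>R b) + s *\<^sub>R a) - f (u + s *\<^sub>R a)"] DERIV_diff D f1)
       (auto simp: algebra_simps)
  then obtain s where s: "0 < s" "s < h" and e1: "f (u + h *\<^sub>R a + h *\<^sub>R b) - f (u + h *\<^sub>R a) - f (u + h *\<^sub>R b) + f u
      = h * (fa ((u + s *\<^sub>R a) + h *\<^sub>R b) - fa ((u + s *\<^sub>R a) + 0 *\<^sub>R b))"
    by (auto simp: algebra_simps)
  have "\<exists>t>0. t < h \<and> fa ((u + s *\<^sub>R a) + h *\<^sub>R b) - fa ((u + s *\<^sub>R a) + 0 *\<^sub>R b)
     = (h - 0) * frechet_derivative fa (at (u + s *\<^sub>R a + t *\<^sub>R b)) b"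
    using h s U[of s] by (intro MVT2[of 0 h "\<lambda>t. fa ((u + s *\<^sub>R a) + t *\<^sub>R b)"] D f1) auto
  then show ?thesis using that[of s] s e1 unfolding fa_def[symmetric] by auto
qed

lemma second_derivative_symmetric:
  fixes f :: "'a::euclidean_space \<Rightarrow> real"
  assumes U: "open U" "u \<in> U" and f: "Ck_on 2 f U" and ab: "a \<in> Basis" "b \<in> Basis"
  shows "frechet_derivative (\<lambda>x. frechet_derivative f (at x) a) (at u) b =
         frechet_derivative (\<lambda>x. frechet_derivative f (at x) b) (at u) a"
    (is "?p u = ?q u")
proof (rule ccontr)
  assume ne: "?p u \<noteq> ?q u"
  \<comment> \<open>Half the gap: a common value of \<open>?p\<close> and \<open>?q\<close> at
    nearby points cannot lie within \<open>e\<close> of both limits.\<close>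
  define e where "e = \<bar>?p u - ?q u\<bar> / 2"
  have e: "e > 0" using ne by (simp add: e_def)
  have c: "continuous_on U ?p" "continuous_on U ?q" using f ab by (auto simp: numeral_2_eq_2)
  obtain d1 where d1: "d1 > 0" "\<And>x. x \<in> U \<Longrightarrow> dist x u < d1 \<Longrightarrow> dist (?p x) (?p u) < e"
    using c(1) U e unfolding continuous_on_iff by metis
  obtain d2 where d2: "d2 > 0" "\<And>x. x \<in> U \<Longrightarrow> dist x u < d2 \<Longrightarrow> dist (?q x) (?q u) < e"
    using c(2) U e unfolding continuous_on_iff by metis
  obtain d3 where d3: "d3 > 0" "ball u d3 \<subseteq> U" using U openE by blast
  \<comment> \<open>Points of the square of side \<open>h\<close> are at distance at most
    \<open>2 * h\<close> from \<open>u\<close>, hence strictly less than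
    \<open>3 * h\<close>.\<close>
  define h where "h = Min {d1, d2, d3} / 3"
  have h: "0 < h" "3 * h \<le> d1" "3 * h \<le> d2" "3 * h \<le> d3" using d1 d2 d3 by (auto simp: h_def)
  have near: "dist (u + s *\<^sub>R v + t *\<^sub>R w) u < 3 * h"
    if "0 \<le> s" "s \<le> h" "0 \<le> t" "t \<le> h" "v \<in> Basis" "w \<in> Basis" for s t and v w :: 'a
    using norm_triangle_ineq[of "s *\<^sub>R v" "t *\<^sub>R w"] that h by (simp add: dist_norm add.assoc)
  have inU: "u + s *\<^sub>R v + t *\<^sub>R w \<in> U"
    if "0 \<le> s" "s \<le> h" "0 \<le> t" "t \<le> h" "v \<in> Basis" "w \<in> Basis" for s t and v w :: 'a
    using near[OF that] h d3(2) by (auto simp: dist_commute)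
  obtain s t where st: "0 < s" "s < h" "0 < t" "t < h"
    "f (u + h *\<^sub>R a + h *\<^sub>R b) - f (u + h *\<^sub>R a) - f (u + h *\<^sub>R b) + f u = h * h * ?p (u + s *\<^sub>R a + t *\<^sub>R b)"
    by (rule second_difference[OF f h(1) ab]) (use inU ab in auto)
  obtain s' t' where st': "0 < s'" "s' < h" "0 < t'" "t' < h"
    "f (u + h *\<^sub>R b + h *\<^sub>R a) - f (u + h *\<^sub>R b) - f (u + h *\<^sub>R a) + f u = h * h * ?q (u + s' *\<^sub>R b + t' *\<^sub>R a)"
    by (rule second_difference[OF f h(1) ab(2,1)]) (use inU ab in auto)
  \<comment> \<open>The second difference does not change when \<open>a\<close> and \<open>b\<close>
    are exchanged.\<close>
  have "h * h * ?p (u + s *\<^sub>R a + t *\<^sub>R b) = h * h * ?q (u + s' *\<^sub>R b + t' *\<^sub>R a)"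
    using st(5) st'(5) by (simp add: algebra_simps)
  then have "?p (u + s *\<^sub>R a + t *\<^sub>R b) = ?q (u + s' *\<^sub>R b + t' *\<^sub>R a)" using h by simp
  moreover have "dist (?p (u + s *\<^sub>R a + t *\<^sub>R b)) (?p u) < e"
    using st ab h near[of s t a b] inU[of s t a b] by (intro d1) auto
  moreover have "dist (?q (u + s' *\<^sub>R b + t' *\<^sub>R a)) (?q u) < e"
    using st' ab h near[of s' t' b a] inU[of s' t' b a] by (intro d2) auto
  ultimately show False by (auto simp: e_def dist_real_def abs_if split: if_splits)
qed

text \<open>The vector-valued case follows from the scalar one, applied to each component
  \<open>f x \<bullet> b\<close>.\<close>

lemma partial_commute:
  fixes f :: "real ^ 'k::finite \<Rightarrow> 'v::euclidean_space"
  assumes U: "open U" "u \<in> U" and f: "Ck_on 2 f U"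
  shows "partial i (partial j f) u = partial j (partial i f) u"
proof (rule euclidean_eqI)
  fix b :: 'v assume "b \<in> Basis"
  have d: "f differentiable (at x)" "partial l f differentiable (at x)" if "x \<in> U" for x l
    using that f Ck_on_partial[of "Suc 0" f U l] by (auto simp: numeral_2_eq_2)
  have *: "partial i (partial j (\<lambda>x. f x \<bullet> b)) u = partial i (partial j f) u \<bullet> b" for i j
  proof -
    have "partial i (\<lambda>x. partial j f x \<bullet> b) u = partial i (partial j (\<lambda>x. f x \<bullet> b)) u"
      using d U by (intro partial_cong[OF U]) (auto simp: partial_inner)
    then show ?thesis using d U by (simp add: partial_inner)
  qed
  have "Ck_on 2 (\<lambda>x. f x \<bullet> b) U"
    by (intro Ck_on_inner U f Ck_on_const)
  then have "partial i (partial j (\<lambda>x. f x \<bullet> b)) u = partial j (partial i (\<lambda>x. f x \<bullet> b)) u"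
    unfolding partial_def[abs_def]
    by (intro second_derivative_symmetric[OF U]) (auto simp: axis_in_Basis_iff)
  then show "partial i (partial j f) u \<bullet> b = partial j (partial i f) u \<bullet> b"
    by (simp add: *)
qed

section \<open>Curvature of a metric given by a frame\<close>

lemma differentiable_det:
  fixes A :: "'a::real_normed_vector \<Rightarrow> real ^ 'n::finite ^ 'n"
  assumes "\<And>i j. (\<lambda>x. A x $ i $ j) differentiable (at u)"
  shows "(\<lambda>x. det (A x)) differentiable (at u)"
proof -
  have "(\<lambda>x. \<Prod>i\<in>I. A x $ i $ p i) differentiable (at u)" if "finite I" for I p
    using that by (induction I rule: finite_induct) (simp_all add: assms)
  then show ?thesis unfolding det_def
    by (intro differentiable_sum ballI differentiable_mult differentiable_const) simp_all
qed

lemma matrix_inv_mult: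
  fixes A :: "real ^ 'n::finite ^ 'n"
  assumes "invertible A"
  shows "A ** matrix_inv A = mat 1" "matrix_inv A ** A = mat 1"
  using someI_ex[OF assms[unfolded invertible_def]] unfolding matrix_inv_def by auto

text \<open>Expresses the entries of the inverse, which \<open>matrix_inv\<close> only specifies by
  choice, as quotients of determinants; these can be differentiated.\<close>

lemma matrix_inv_cramer:
  fixes A :: "real ^ 'n::finite ^ 'n"
  assumes "invertible A"
  shows "matrix_inv A $ k $ l = det (\<chi> i j. if j = k then axis l 1 $ i else A $ i $ j) / det A"
proof -
  have "A *v (matrix_inv A *v axis l 1) = axis l 1"
    by (simp add: matrix_vector_mul_assoc matrix_inv_mult[OF assms])
  then have "matrix_inv A *v axis l 1 = (\<chi> k. det (\<chi> i j. if j = k then axis l 1 $ i else A $ i $ j) / det A)"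
    using assms by (simp add: cramer invertible_det_nz)
  then have "(matrix_inv A *v axis l 1) $ k = det (\<chi> i j. if j = k then axis l 1 $ i else A $ i $ j) / det A"
    by simp
  then show ?thesis
    by (simp add: matrix_vector_mult_basis column_def)
qed

lemma differentiable_matrix_inv:
  fixes A :: "'a::real_normed_vector \<Rightarrow> real ^ 'n::finite ^ 'n"
  assumes U: "open U" "u \<in> U" and inv: "\<And>x. x \<in> U \<Longrightarrow> invertible (A x)"
    and d: "\<And>i j. (\<lambda>x. A x $ i $ j) differentiable (at u)"
  shows "(\<lambda>x. matrix_inv (A x) $ k $ l) differentiable (at u)"
proof -
  let ?f = "\<lambda>x. det (\<chi> i j. if j = k then axis l 1 $ i else A x $ i $ j) / det (A x)"
  have "(\<lambda>x. if j = k then axis l 1 $ i else A x $ i $ j) differentiable (at u)" for i j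
    by (cases "j = k") (simp_all add: d)
  then have "?f differentiable (at u)"
    using d U(2) inv by (intro differentiable_divide differentiable_det)
      (simp_all add: invertible_det_nz)
  then show ?thesis
    by (rule differentiable_cong_open[OF _ U]) (simp add: matrix_inv_cramer[OF inv])
qed

text \<open>The frame \<open>E\<close> may take values in a Euclidean space of larger dimension. The metric connection
  with matrices \<open>B\<close> has no torsion (\<open>S_sym\<close>) and preserves the span of the frame (\<open>S_tangent\<close>), so
  it is the Levi-Civita connection.\<close>

locale frame =
  fixes U :: "(real ^ 'k::finite) set" and G :: "real ^ 'k \<Rightarrow> real ^ 'k ^ 'k"
    and E :: "'k \<Rightarrow> real ^ 'k \<Rightarrow> 'v::euclidean_space"
    and B :: "'k \<Rightarrow> real ^ 'k \<Rightarrow> 'v \<Rightarrow> 'v"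
    and S :: "'k \<Rightarrow> 'k \<Rightarrow> real ^ 'k \<Rightarrow> 'v"
  assumes open_U: "open U"
    and G: "\<And>u i j. u \<in> U \<Longrightarrow> G u $ i $ j = E i u \<bullet> E j u"
    and E_diff: "\<And>u i. u \<in> U \<Longrightarrow> E i differentiable (at u)"
    and S_diff: "\<And>u i j. u \<in> U \<Longrightarrow> S i j differentiable (at u)"
    and indep: "\<And>u v. u \<in> U \<Longrightarrow> (\<Sum>i\<in>UNIV. v $ i *\<^sub>R E i u) = 0 \<Longrightarrow> v = 0"
    and S_eq: "\<And>u i j. u \<in> U \<Longrightarrow> S i j u = partial j (E i) u + B j u (E i u)"
    and B_linear: "\<And>u j. linear (B j u)"
    and B_skew: "\<And>u j x y. B j u x \<bullet> y = - (x \<bullet> B j u y)"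
    and S_sym: "\<And>u i j. u \<in> U \<Longrightarrow> S i j u = S j i u"
    and S_tangent: "\<And>u i j. u \<in> U \<Longrightarrow> S i j u \<in> range (\<lambda>v. \<Sum>k\<in>UNIV. v $ k *\<^sub>R E k u)"
begin

text \<open>For \<open>u \<in> U\<close> these are the frame coefficients of the orthogonal
  projection of \<open>w\<close> to the span of the frame, so the formula is linear in
  \<open>w\<close> on the whole ambient space.\<close>

definition coef :: "real ^ 'k \<Rightarrow> 'v \<Rightarrow> 'k \<Rightarrow> real" where
  "coef u w k = (\<Sum>l\<in>UNIV. matrix_inv (G u) $ k $ l * (w \<bullet> E l u))"

text \<open>\<open>G u\<close> is the Gram matrix of the frame:
  \<open>v \<bullet> (G u *v v)\<close> is the squared norm of the combination with coefficients
  \<open>v\<close>, which vanishes only for \<open>v = 0\<close>.\<close>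

lemma G_invertible:
  assumes "u \<in> U"
  shows "invertible (G u)"
proof -
  have "v = 0" if "G u *v v = 0" for v
  proof (rule indep[OF assms])
    have "(\<Sum>i\<in>UNIV. v $ i *\<^sub>R E i u) \<bullet> (\<Sum>i\<in>UNIV. v $ i *\<^sub>R E i u) = v \<bullet> (G u *v v)"
      by (simp add: inner_sum_left inner_sum_right inner_vec_def matrix_vector_mult_def G[OF assms]
          sum_distrib_left mult_ac) (simp add: inner_commute)
    then show "(\<Sum>i\<in>UNIV. v $ i *\<^sub>R E i u) = 0" using that by simp
  qed
  then show ?thesis
    using matrix_left_invertible_ker invertible_left_inverse by metis
qed

lemma coef_sum:
  assumes "u \<in> U"
  shows "coef u (\<Sum>k\<in>UNIV. c k *\<^sub>R E k u) k = c k"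
proof -
  have "coef u (\<Sum>k\<in>UNIV. c k *\<^sub>R E k u) k = (matrix_inv (G u) *v (G u *v (\<chi> k. c k))) $ k"
    by (simp add: coef_def inner_sum_left matrix_vector_mult_def G[OF assms] mult_ac)
      (simp add: inner_commute)
  also have "\<dots> = c k"
    by (simp only: matrix_vector_mul_assoc matrix_inv_mult[OF G_invertible[OF assms]]) simp
  finally show ?thesis .
qed

lemma coef_frame: "u \<in> U \<Longrightarrow> coef u (E m u) k = (if k = m then 1 else 0)"
  using coef_sum[of u "\<lambda>k. if k = m then 1 else 0" k]
  by (simp add: if_distrib[where f = "\<lambda>c. c *\<^sub>R _"] cong: if_cong)

lemma coef_add: "coef u (x + y) k = coef u x k + coef u y k"
  by (simp add: coef_def inner_add_left distrib_left sum.distrib)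

lemma coef_scaleR: "coef u (c *\<^sub>R x) k = c * coef u x k"
  by (simp add: coef_def sum_distrib_left mult_ac)

lemma coef_diff: "coef u (x - y) k = coef u x k - coef u y k"
  by (simp add: coef_def inner_diff_left right_diff_distrib sum_subtractf)

lemma expansion:
  assumes "u \<in> U" "w \<in> range (\<lambda>v. \<Sum>k\<in>UNIV. v $ k *\<^sub>R E k u)"
  shows "w = (\<Sum>k\<in>UNIV. coef u w k *\<^sub>R E k u)"
  using assms(2) coef_sum[OF assms(1), of "($) _"] by auto

text \<open>The left-hand side is the trace, on the span of the frame, of the rank-one map sending
  \<open>w\<close> to \<open>(w \<bullet> x) *\<^sub>R y\<close>.\<close>

lemma trace_rank_one:
  assumes "u \<in> U" "y \<in> range (\<lambda>v. \<Sum>k\<in>UNIV. v $ k *\<^sub>R E k u)"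
  shows "(\<Sum>k\<in>UNIV. coef u y k * (E k u \<bullet> x)) = y \<bullet> x"
  by (subst (2) expansion[OF assms]) (simp add: inner_sum_left)

text \<open>This is the Koszul formula. Skewness of \<open>B\<close> makes the connection metric,
  and in the cyclic sum of derivatives of \<open>G\<close> the symmetry of \<open>S\<close> leaves
  only \<open>2 * (S i j u \<bullet> E l u)\<close>.\<close>

lemma christoffel_eq_coef:
  assumes "u \<in> U"
  shows "christoffel G k i j u = coef u (S i j u) k"
proof -
  have p: "partial i (\<lambda>x. G x $ j $ l) u = S j i u \<bullet> E l u + E j u \<bullet> S l i u" for i j l
  proof -
    have "partial i (\<lambda>x. G x $ j $ l) u = partial i (\<lambda>x. E j x \<bullet> E l x) u"
      using assms by (intro partial_cong[OF open_U, symmetric]) (simp_all add: E_diff G)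
    also have "\<dots> = E j u \<bullet> partial i (E l) u + partial i (E j) u \<bullet> E l u"
      using assms by (simp add: partial_inner E_diff)
    also have "\<dots> = S j i u \<bullet> E l u + E j u \<bullet> S l i u"
      using assms by (simp add: S_eq inner_add_left inner_add_right B_skew)
    finally show ?thesis .
  qed
  have "partial i (\<lambda>x. G x $ j $ l) u + partial j (\<lambda>x. G x $ i $ l) u - partial l (\<lambda>x. G x $ i $ j) u
      = 2 * (S i j u \<bullet> E l u)" for l
    using S_sym[OF assms, of i j] S_sym[OF assms, of l i] S_sym[OF assms, of l j]
    by (simp add: p inner_commute)
  then show ?thesis unfolding christoffel_def coef_def
    by (simp add: sum_distrib_left)
qed

lemma christoffel_sym: "u \<in> U \<Longrightarrow> christoffel G k i j u = christoffel G k j i u"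
  by (simp add: christoffel_eq_coef S_sym[of u i j])

lemma S_expansion:
  "u \<in> U \<Longrightarrow> S i j u = (\<Sum>k\<in>UNIV. christoffel G k i j u *\<^sub>R E k u)"
  using expansion[OF _ S_tangent] by (simp add: christoffel_eq_coef)

text \<open>Read off from \<open>coef u (S i j u) k\<close>, where all ingredients are known to be
  differentiable; the definition of \<open>christoffel\<close> already contains derivatives of
  \<open>G\<close>.\<close>

lemma christoffel_differentiable:
  assumes "u \<in> U"
  shows "christoffel G k i j differentiable (at u)"
proof -
  have GD: "(\<lambda>x. G x $ i $ j) differentiable (at u)" for i j
  proof -
    have "(\<lambda>x. E i x \<bullet> E j x) differentiable (at u)" using assms by (simp add: E_diff)
    then show ?thesis by (rule differentiable_cong_open[OF _ open_U assms]) (simp add: G)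
  qed
  have "(\<lambda>u. coef u (S i j u) k) differentiable (at u)" unfolding coef_def
    using assms by (intro differentiable_sum ballI differentiable_mult differentiable_inner S_diff E_diff
        differentiable_matrix_inv[OF open_U] G_invertible GD) simp_all
  then show ?thesis by (rule differentiable_cong_open[OF _ open_U assms]) (simp add: christoffel_eq_coef)
qed

lemma covariant_derivative_S:
  assumes "u \<in> U"
  shows "partial m (S i j) u + B m u (S i j u) =
    (\<Sum>k\<in>UNIV. (partial m (christoffel G k i j) u
      + (\<Sum>l\<in>UNIV. christoffel G k l m u * christoffel G l i j u)) *\<^sub>R E k u)"
proof -
  let ?C = "\<lambda>k i j. christoffel G k i j u"
  note d = christoffel_differentiable[OF assms] E_diff[OF assms]
  have "partial m (S i j) u = partial m (\<lambda>x. \<Sum>k\<in>UNIV. christoffel G k i j x *\<^sub>R E k x) u"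
    using assms S_expansion by (intro partial_cong[OF open_U assms S_diff])
  also have "\<dots> = (\<Sum>k\<in>UNIV. ?C k i j *\<^sub>R partial m (E k) u + partial m (christoffel G k i j) u *\<^sub>R E k u)"
    by (simp add: partial_sum partial_scaleR d)
  finally have 1: "partial m (S i j) u =
    (\<Sum>k\<in>UNIV. ?C k i j *\<^sub>R partial m (E k) u + partial m (christoffel G k i j) u *\<^sub>R E k u)" .
  have 2: "B m u (S i j u) = (\<Sum>k\<in>UNIV. ?C k i j *\<^sub>R B m u (E k u))"
    by (simp add: S_expansion[OF assms] linear_sum[OF B_linear] linear_cmul[OF B_linear])
  \<comment> \<open>The terms with \<open>partial m (E k)\<close> and \<open>B m u (E k u)\<close>
    combine to \<open>S k m u\<close>, which is expanded once more in the frame; this produces the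
    quadratic terms of the curvature.\<close>
  have "(\<Sum>k\<in>UNIV. ?C k i j *\<^sub>R S k m u) = (\<Sum>l\<in>UNIV. \<Sum>k\<in>UNIV. (?C k l m * ?C l i j) *\<^sub>R E k u)"
    by (simp add: S_expansion[OF assms] scaleR_sum_right mult_ac)
  also have "\<dots> = (\<Sum>k\<in>UNIV. (\<Sum>l\<in>UNIV. ?C k l m * ?C l i j) *\<^sub>R E k u)"
    by (subst sum.swap) (simp add: scaleR_sum_left)
  finally show ?thesis unfolding 1 2
    by (simp add: S_eq[OF assms] scaleR_add_left scaleR_add_right sum.distrib)
qed

text \<open>Commuting covariant derivatives gives the curvature of the connection; its coefficients
  are the coordinate formula up to the order of the lower indices in the quadratic terms, which
  \<open>christoffel_sym\<close> settles.\<close>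

lemma ricci_eq_trace:
  assumes "u \<in> U"
  shows "ricci G i j u = (\<Sum>k\<in>UNIV. coef u
    ((partial k (S i j) u + B k u (S i j u)) - (partial j (S i k) u + B j u (S i k u))) k)"
proof -
  have "ricci G i j u =
    (\<Sum>k\<in>UNIV. partial k (christoffel G k i j) u - partial j (christoffel G k i k) u) +
    (\<Sum>k\<in>UNIV. \<Sum>l\<in>UNIV. christoffel G k l k u * christoffel G l i j u
       - christoffel G k l j u * christoffel G l i k u)"
    unfolding ricci_def
    by (intro arg_cong2[where f = "(+)"] sum.cong refl) (metis christoffel_sym[OF assms])
  then show ?thesis
    by (simp only: coef_diff covariant_derivative_S[OF assms] coef_sum[OF assms])
      (simp add: sum_subtractf sum.distrib)
qed

end

section \<open>Warped products with round spheres\<close>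

text \<open>Points of the warped product have coordinates \<open>T\<close> on the line and \<open>X\<close> on a sphere
  of radius \<open>1 / sqrt \<kappa>\<close>; the metric is \<open>dT\<^sup>2 + \<psi>(T)\<^sup>2 |dX|\<^sup>2\<close>.\<close>

locale warped =
  fixes U :: "(real ^ 'k::finite) set"
    and T :: "real ^ 'k \<Rightarrow> real" and X :: "real ^ 'k \<Rightarrow> 'w::euclidean_space"
    and \<kappa> :: real and \<psi> \<psi>1 \<psi>2 :: "real \<Rightarrow> real"
  assumes U: "open U"
    and T: "Ck_on 3 T U" and X: "Ck_on 3 X U"
    and X_sphere: "\<And>u. u \<in> U \<Longrightarrow> \<kappa> * (X u \<bullet> X u) = 1"
    and \<psi>: "\<And>t. (\<psi> has_real_derivative \<psi>1 t) (at t)"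
    and \<psi>1: "\<And>t. (\<psi>1 has_real_derivative \<psi>2 t) (at t)"
    and \<psi>_pos: "\<And>t. \<psi> t > 0"
begin

definition h :: "'k \<Rightarrow> 'k \<Rightarrow> real ^ 'k \<Rightarrow> real" where
  "h i j u = partial i X u \<bullet> partial j X u"

definition E :: "'k \<Rightarrow> real ^ 'k \<Rightarrow> real \<times> 'w" where
  "E i u = (partial i T u, \<psi> (T u) *\<^sub>R partial i X u)"

text \<open>A sum of two infinitesimal rotations: one in the plane of the line and
  \<open>partial m X u\<close>, with factor \<open>\<psi>1 (T u)\<close>, accounts for the warping;
  the other, in the plane of \<open>X u\<close> and \<open>partial m X u\<close> with factor
  \<open>\<kappa>\<close>, removes the component normal to the sphere.\<close>

definition B :: "'k \<Rightarrow> real ^ 'k \<Rightarrow> real \<times> 'w \<Rightarrow> real \<times> 'w" where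
  "B m u p = (- \<psi>1 (T u) * (partial m X u \<bullet> snd p),
     (fst p * \<psi>1 (T u)) *\<^sub>R partial m X u
     + (\<kappa> * (partial m X u \<bullet> snd p)) *\<^sub>R X u - (\<kappa> * (X u \<bullet> snd p)) *\<^sub>R partial m X u)"

text \<open>The covariant derivative of \<open>E i\<close> in direction \<open>j\<close>, simplified
  by \<open>X \<bullet> partial i X = 0\<close>, so that its symmetry reduces to the commutation of
  second partial derivatives.\<close>

definition S :: "'k \<Rightarrow> 'k \<Rightarrow> real ^ 'k \<Rightarrow> real \<times> 'w" where
  "S i j u = (partial j (partial i T) u
       - (\<psi> (T u) * \<psi>1 (T u)) * (partial i X u \<bullet> partial j X u),
     \<psi>1 (T u) *\<^sub>R (partial j T u *\<^sub>R partial i X u + partial i T u *\<^sub>R partial j X u)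
     + \<psi> (T u) *\<^sub>R (partial j (partial i X) u + (\<kappa> * (partial i X u \<bullet> partial j X u)) *\<^sub>R X u))"

lemma Ck_partials:
  "Ck_on 2 T U" "Ck_on 2 X U" "Ck_on 2 (partial i T) U" "Ck_on 2 (partial i X) U"
  using Ck_on_partial[of 2 T U i] Ck_on_partial[of 2 X U i] T X
    Ck_on_mono[OF T, of 2] Ck_on_mono[OF X, of 2]
  by (simp_all add: numeral_3_eq_3 numeral_2_eq_2 del: Ck_on.simps)

lemma differentiables:
  assumes "u \<in> U"
  shows "T differentiable (at u)" "X differentiable (at u)"
    "partial i T differentiable (at u)" "partial i X differentiable (at u)"
    "partial j (partial i T) differentiable (at u)" "partial j (partial i X) differentiable (at u)"
    "(\<lambda>u. \<psi> (T u)) differentiable (at u)" "(\<lambda>u. \<psi>1 (T u)) differentiable (at u)"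
proof -
  have d: "f differentiable (at u)" "partial j f differentiable (at u)"
    if "Ck_on 2 f U" for f :: "real ^ 'k \<Rightarrow> 'c::real_normed_vector" and j
    using that Ck_on_partial[of 1 f U j] Ck_on_Suc_differentiable[OF _ assms, of 0]
      Ck_on_Suc_differentiable[OF _ assms, of 1]
    by (simp_all add: numeral_2_eq_2 del: Ck_on.simps)
  show "T differentiable (at u)" "X differentiable (at u)"
    "partial i T differentiable (at u)" "partial i X differentiable (at u)"
    "partial j (partial i T) differentiable (at u)" "partial j (partial i X) differentiable (at u)"
    by (intro d Ck_partials)+
  then show "(\<lambda>u. \<psi> (T u)) differentiable (at u)" "(\<lambda>u. \<psi>1 (T u)) differentiable (at u)"
    using differentiable_compose_real \<psi> \<psi>1 by blast+
qed

text \<open>Differentiates the equation of the sphere; differentiating the result once more gives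
  \<open>X_second\<close>.\<close>

lemma X_orthogonal:
  assumes "u \<in> U"
  shows "X u \<bullet> partial i X u = 0"
proof -
  note d = differentiables[OF assms]
  have "\<kappa> \<noteq> 0" using X_sphere[OF assms] by auto
  have "partial i (\<lambda>u. \<kappa> * (X u \<bullet> X u)) u = partial i (\<lambda>u. 1) u"
    using assms by (intro partial_cong[OF U]) (simp_all add: d X_sphere)
  then show ?thesis using \<open>\<kappa> \<noteq> 0\<close>
    by (simp add: partial_mult partial_inner d inner_commute)
qed

lemma X_second:
  assumes "u \<in> U"
  shows "X u \<bullet> partial j (partial i X) u = - h i j u"
proof -
  note d = differentiables[OF assms]
  have "partial j (\<lambda>u. X u \<bullet> partial i X u) u = partial j (\<lambda>u. 0) u"
    using assms by (intro partial_cong[OF U]) (simp_all add: d X_orthogonal)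
  then show ?thesis
    by (simp add: partial_inner d h_def inner_commute)
qed

lemma B_linear: "linear (B m u)"
  by (intro linearI prod_eqI; simp add: B_def algebra_simps inner_simps)

lemma B_skew: "B m u x \<bullet> y = - (x \<bullet> B m u y)"
  by (cases x; cases y) (simp add: B_def inner_prod_def inner_simps inner_commute algebra_simps)

lemma S_eq:
  assumes "u \<in> U"
  shows "S i j u = partial j (E i) u + B j u (E i u)"
proof -
  note d = differentiables[OF assms]
  have "partial j (E i) u = (partial j (partial i T) u, \<psi> (T u) *\<^sub>R partial j (partial i X) u
     + (\<psi>1 (T u) * partial j T u) *\<^sub>R partial i X u)"
    unfolding E_def[abs_def]
    by (simp add: partial_Pair partial_scaleR partial_compose_real[OF \<psi>] d)
  then show ?thesis
    by (simp add: S_def B_def E_def X_orthogonal[OF assms] inner_commute algebra_simps)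
qed

lemma S_sym: "u \<in> U \<Longrightarrow> S i j u = S j i u"
  using partial_commute[OF U _ Ck_partials(1), of u i j] partial_commute[OF U _ Ck_partials(2), of u i j]
  by (simp add: S_def inner_commute add.commute)

lemma S_differentiable: "u \<in> U \<Longrightarrow> S i j differentiable (at u)"
  unfolding S_def[abs_def] by (simp add: differentiable_Pair differentiables)

text \<open>The normal component of the second derivative of \<open>X\<close>, given by
  \<open>X_second\<close>, is cancelled by the \<open>\<kappa>\<close> term because
  \<open>\<kappa> * (X u \<bullet> X u) = 1\<close>.\<close>

lemma S_orthogonal: "u \<in> U \<Longrightarrow> X u \<bullet> snd (S i j u) = 0"
  using X_sphere[of u]
  by (simp add: S_def inner_simps X_orthogonal X_second h_def[symmetric])

lemma partial_S:
  assumes "u \<in> U"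
  shows "partial m (S i j) u =
    (partial m (partial j (partial i T)) u
     - (\<psi> (T u) * \<psi>2 (T u) + \<psi>1 (T u) * \<psi>1 (T u)) * partial m T u * h i j u
     - (\<psi> (T u) * \<psi>1 (T u)) * (partial i X u \<bullet> partial m (partial j X) u
          + partial m (partial i X) u \<bullet> partial j X u),
     (\<psi>2 (T u) * partial m T u) *\<^sub>R (partial j T u *\<^sub>R partial i X u + partial i T u *\<^sub>R partial j X u)
     + \<psi>1 (T u) *\<^sub>R (partial m (partial j T) u *\<^sub>R partial i X u
          + partial j T u *\<^sub>R partial m (partial i X) u
          + partial m (partial i T) u *\<^sub>R partial j X u
          + partial i T u *\<^sub>R partial m (partial j X) u)
     + (\<psi>1 (T u) * partial m T u) *\<^sub>R (partial j (partial i X) u + (\<kappa> * h i j u) *\<^sub>R X u)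
     + \<psi> (T u) *\<^sub>R (partial m (partial j (partial i X)) u
          + (\<kappa> * (partial i X u \<bullet> partial m (partial j X) u
             + partial m (partial i X) u \<bullet> partial j X u)) *\<^sub>R X u
          + (\<kappa> * h i j u) *\<^sub>R partial m X u))"
  unfolding S_def[abs_def] h_def
  by (simp add: partial_Pair partial_scaleR partial_mult partial_add partial_diff partial_inner
      partial_compose_real[OF \<psi>] partial_compose_real[OF \<psi>1] differentiables[OF assms])
    (simp add: algebra_simps)

text \<open>The left-hand side is the curvature of the connection, applied to \<open>E i\<close>.\<close>

lemma curvature:
  assumes "u \<in> U"
  shows "(partial k (S i j) u + B k u (S i j u)) - (partial j (S i k) u + B j u (S i k u)) =
    (- \<psi> (T u) * \<psi>2 (T u) * (partial k T u * h i j u - partial j T u * h i k u),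
     (\<psi>2 (T u) * partial i T u) *\<^sub>R (partial k T u *\<^sub>R partial j X u - partial j T u *\<^sub>R partial k X u)
     + (\<psi> (T u) * (\<kappa> - (\<psi>1 (T u))\<^sup>2)) *\<^sub>R (h i j u *\<^sub>R partial k X u - h i k u *\<^sub>R partial j X u))"
    (is "?L = ?R")
proof (rule prod_eqI)
  \<comment> \<open>The terms of third order in the two covariant derivatives cancel after
    exchanging \<open>k\<close> and \<open>j\<close>.\<close>
  have third: "partial k (partial j (partial i T)) u = partial j (partial k (partial i T)) u"
    "partial k (partial j (partial i X)) u = partial j (partial k (partial i X)) u"
    by (intro partial_commute[OF U assms] Ck_partials)+
  have second: "partial k (partial j T) u = partial j (partial k T) u"
    "partial k (partial j X) u = partial j (partial k X) u"
    by (intro partial_commute[OF U assms] Ck_partials)+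
  have hs: "h a b u = h b a u" for a b by (simp add: h_def inner_commute)
  have Bfst: "fst (B m u (S i j u)) = - \<psi>1 (T u) * (\<psi>1 (T u) * (partial j T u * h m i u + partial i T u * h m j u)
      + \<psi> (T u) * (partial m X u \<bullet> partial j (partial i X) u))" for m i j
    using X_orthogonal[OF assms, of m]
    by (simp add: B_def S_def inner_simps h_def inner_commute)
  have Bsnd: "snd (B m u (S i j u)) = ((partial j (partial i T) u
       - (\<psi> (T u) * \<psi>1 (T u)) * h i j u) * \<psi>1 (T u)) *\<^sub>R partial m X u
     + (\<kappa> * (\<psi>1 (T u) * (partial j T u * h m i u + partial i T u * h m j u)
      + \<psi> (T u) * (partial m X u \<bullet> partial j (partial i X) u))) *\<^sub>R X u" for m i j
    using X_orthogonal[OF assms, of m] S_orthogonal[OF assms, of i j]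
    by (simp add: B_def S_def inner_simps h_def inner_commute)
  show "fst ?L = fst ?R"
    by (simp add: Bfst partial_S[OF assms] third second
        hs[of j i] hs[of k i] hs[of k j] inner_commute power2_eq_square algebra_simps)
  show "snd ?L = snd ?R"
    by (simp add: Bsnd partial_S[OF assms] third second
        hs[of j i] hs[of k i] hs[of k j] inner_commute power2_eq_square algebra_simps)
qed

end

text \<open>Independence and tangency are assumptions here, because they rest on dimension counts
  that differ between the sphere, where \<open>T\<close> is constant, and the warped
  product.\<close>

locale warped_frame = warped +
  fixes G :: "real ^ 'a \<Rightarrow> real ^ 'a ^ 'a"
  assumes G: "\<And>u i j. u \<in> U \<Longrightarrow> G u $ i $ j =
      partial i T u * partial j T u + (\<psi> (T u))\<^sup>2 * (partial i X u \<bullet> partial j X u)"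
    and indep: "\<And>u v. u \<in> U \<Longrightarrow> (\<Sum>i\<in>UNIV. v $ i *\<^sub>R E i u) = 0 \<Longrightarrow> v = 0"
    and S_tangent: "\<And>u i j. u \<in> U \<Longrightarrow> S i j u \<in> range (\<lambda>v. \<Sum>k\<in>UNIV. v $ k *\<^sub>R E k u)"
begin

sublocale frame U G E B S
proof
  show "E i differentiable (at u)" if "u \<in> U" for i u
    unfolding E_def[abs_def] using that by (simp add: differentiable_Pair differentiables)
  show "G u $ i $ j = E i u \<bullet> E j u" if "u \<in> U" for u i j
    using that by (simp add: G E_def power2_eq_square)
  show "S i j u = S j i u" if "u \<in> U" for u i j by (rule S_sym[OF that])
  show "S i j u \<in> range (\<lambda>v. \<Sum>k\<in>UNIV. v $ k *\<^sub>R E k u)" if "u \<in> U" for u i j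
    by (rule S_tangent[OF that])
qed (simp_all add: U indep S_eq S_differentiable linear_add[OF B_linear]
      linear_cmul[OF B_linear] B_skew)

lemma ricci_round:
  assumes u: "u \<in> U" and T0: "\<And>i. partial i T u = 0" and \<psi>2: "\<psi>2 (T u) = 0"
  shows "ricci G i j u = (real CARD('a) - 1) * (\<kappa> - (\<psi>1 (T u))\<^sup>2) * h i j u"
proof -
  let ?p = "\<psi> (T u)" and ?c = "\<kappa> - (\<psi>1 (T u))\<^sup>2"
  have p: "?p > 0" by (rule \<psi>_pos)
  \<comment> \<open>With the \<open>T\<close> terms gone, this is the curvature of a space of
    constant curvature; the trace of its first term counts the dimension and that of the second
    subtracts one.\<close>
  have "(partial k (S i j) u + B k u (S i j u)) - (partial j (S i k) u + B j u (S i k u))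
    = (?c * h i j u) *\<^sub>R E k u - (?c * h i k u) *\<^sub>R E j u" for k
    unfolding curvature[OF u] by (simp add: T0 \<psi>2 E_def algebra_simps)
  then have "ricci G i j u = (\<Sum>k\<in>UNIV. ?c * h i j u * coef u (E k u) k - ?c * h i k u * coef u (E j u) k)"
    unfolding ricci_eq_trace[OF u] by (simp add: coef_diff coef_scaleR)
  also have "\<dots> = ?c * h i j u * real CARD('a) - ?c * h i j u"
    by (simp add: sum_subtractf coef_frame[OF u] if_distrib[where f = "\<lambda>c. _ * c"] cong: if_cong)
  finally show ?thesis by (simp add: algebra_simps)
qed

text \<open>The line component of \<open>S_expansion\<close>; it supplies the Christoffel term in
  the Hessian of a function of \<open>T\<close>.\<close>

lemma christoffel_T:
  "u \<in> U \<Longrightarrow> (\<Sum>k\<in>UNIV. christoffel G k i j u * partial k T u) =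
    partial j (partial i T) u - \<psi> (T u) * \<psi>1 (T u) * h i j u"
  using arg_cong[OF S_expansion, of u fst i j] by (simp add: S_def E_def fst_sum h_def)

text \<open>Splits the frame into its parts along the line and along the sphere; the curvature then
  becomes a combination of rank-one terms and a multiple of the identity on the spherical part,
  whose traces are computed one by one.\<close>

lemma ricci_warped:
  assumes u: "u \<in> U" and e: "(1, 0) \<in> range (\<lambda>v. \<Sum>k\<in>UNIV. v $ k *\<^sub>R E k u)"
  shows "ricci G i j u =
    ((real CARD('a) - 2) * (\<kappa> - (\<psi>1 (T u))\<^sup>2) - \<psi> (T u) * \<psi>2 (T u)) * h i j u
    - (real CARD('a) - 1) * \<psi>2 (T u) / \<psi> (T u) * partial i T u * partial j T u"
proof -
  let ?p = "\<psi> (T u)" and ?q = "\<psi>2 (T u)" and ?c = "\<kappa> - (\<psi>1 (T u))\<^sup>2" and ?n = "real CARD('a)"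
  let ?T = "\<lambda>k. partial k T u" and ?e = "(1, 0) :: real \<times> 'b"
  have p: "?p > 0" by (rule \<psi>_pos)
  define Y where "Y k = (0 :: real, partial k X u)" for k
  have EY: "E k u = ?T k *\<^sub>R ?e + ?p *\<^sub>R Y k" for k by (simp add: E_def Y_def)
  have c: "?p * coef u (Y m) k = coef u (E m u) k - ?T m * coef u ?e k" for k m
    by (simp only: EY coef_add coef_scaleR)
  \<comment> \<open>\<open>?T k\<close> is \<open>E k u \<bullet> ?e\<close>, so the sum is the
    trace of the projection to the line. The following sum vanishes because \<open>Y i\<close> is
    orthogonal to \<open>?e\<close>.\<close>
  have 1: "(\<Sum>k\<in>UNIV. coef u ?e k * ?T k) = 1"
    using trace_rank_one[OF u e, of ?e] by (simp add: E_def)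
  have "(\<Sum>k\<in>UNIV. coef u ?e k * (?p * h i k u)) = 0"
    using trace_rank_one[OF u e, of "Y i"] by (simp add: E_def Y_def h_def inner_commute)
  then have 2: "(\<Sum>k\<in>UNIV. coef u ?e k * h i k u) = 0"
    using p by (simp add: mult.left_commute[of _ ?p] flip: sum_distrib_left)
  have "?p * (\<Sum>k\<in>UNIV. coef u (Y j) k * ?T k) = ?T j - ?T j * (\<Sum>k\<in>UNIV. coef u ?e k * ?T k)"
    by (simp add: sum_distrib_left mult.assoc[symmetric] c left_diff_distrib sum_subtractf coef_frame[OF u]
        if_distrib[where f = "\<lambda>c. c * _"] cong: if_cong)
  then have 3: "(\<Sum>k\<in>UNIV. coef u (Y j) k * ?T k) = 0" using 1 p by simp
  \<comment> \<open>Sending \<open>E k u\<close> to \<open>?p *\<^sub>R Y k\<close> is the identity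
    minus the projection to the line.\<close>
  have 4: "?p * (\<Sum>k\<in>UNIV. coef u (Y k) k) = ?n - 1"
    using 1 by (simp add: sum_distrib_left c sum_subtractf coef_frame[OF u] mult.commute)
  have "?p * (\<Sum>k\<in>UNIV. coef u (Y j) k * h i k u) = h i j u - ?T j * (\<Sum>k\<in>UNIV. coef u ?e k * h i k u)"
    by (simp add: sum_distrib_left mult.assoc[symmetric] c left_diff_distrib sum_subtractf coef_frame[OF u]
        if_distrib[where f = "\<lambda>c. c * _"] cong: if_cong)
  then have 5: "?p * (\<Sum>k\<in>UNIV. coef u (Y j) k * h i k u) = h i j u" using 2 by simp
  have eq: "(partial k (S i j) u + B k u (S i j u)) - (partial j (S i k) u + B j u (S i k u))
    = (- ?p * ?q * (?T k * h i j u - ?T j * h i k u)) *\<^sub>R ?e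
      + (?q * ?T i * ?T k) *\<^sub>R Y j - (?q * ?T i * ?T j) *\<^sub>R Y k
      + (?c * ?p * h i j u) *\<^sub>R Y k - (?c * ?p * h i k u) *\<^sub>R Y j" for k
    unfolding curvature[OF u] by (simp add: Y_def algebra_simps)
  have "ricci G i j u = (\<Sum>k\<in>UNIV.
      - ?p * ?q * h i j u * (coef u ?e k * ?T k) + ?p * ?q * ?T j * (coef u ?e k * h i k u)
      + ?q * ?T i * (coef u (Y j) k * ?T k) - ?q * ?T i * ?T j * coef u (Y k) k
      + ?c * h i j u * ?p * coef u (Y k) k - ?c * ?p * (coef u (Y j) k * h i k u))"
    unfolding ricci_eq_trace[OF u] eq coef_diff coef_add coef_scaleR by (simp add: algebra_simps)
  also have "\<dots> = - ?p * ?q * h i j u * (\<Sum>k\<in>UNIV. coef u ?e k * ?T k)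
      + ?p * ?q * ?T j * (\<Sum>k\<in>UNIV. coef u ?e k * h i k u)
      + ?q * ?T i * (\<Sum>k\<in>UNIV. coef u (Y j) k * ?T k)
      - ?q * ?T i * ?T j * (\<Sum>k\<in>UNIV. coef u (Y k) k)
      + ?c * h i j u * ?p * (\<Sum>k\<in>UNIV. coef u (Y k) k)
      - ?c * ?p * (\<Sum>k\<in>UNIV. coef u (Y j) k * h i k u)"
    by (simp only: sum.distrib sum_subtractf sum_distrib_left)
  also have "\<dots> = - ?p * ?q * h i j u - ?q * ?T i * ?T j * (\<Sum>k\<in>UNIV. coef u (Y k) k)
      + ?c * h i j u * (?p * (\<Sum>k\<in>UNIV. coef u (Y k) k))
      - ?c * (?p * (\<Sum>k\<in>UNIV. coef u (Y j) k * h i k u))"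
    by (simp add: 1 2 3 mult.assoc)
  also have "(\<Sum>k\<in>UNIV. coef u (Y k) k) = (?n - 1) / ?p"
    using 4 p by (simp add: field_simps)
  finally show ?thesis using p by (simp only: 5) (simp add: field_simps)
qed

end

section \<open>Local parametrizations\<close>

lemma Ck_on_id: "Ck_on k (\<lambda>x. x) U"
proof (induction k)
  case (Suc k)
  show ?case by (simp add: Ck_on_const)
qed (simp add: continuous_on_id)

text \<open>A dimension count: the independent frame lies in the orthogonal complement of
  \<open>N\<close> and has as many members as that complement has dimensions.\<close>

lemma frame_spans_hyperplane:
  fixes E :: "'k::finite \<Rightarrow> 'v::euclidean_space"
  assumes indep: "\<And>v :: real ^ 'k. (\<Sum>k\<in>UNIV. v $ k *\<^sub>R E k) = 0 \<Longrightarrow> v = 0"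
    and N: "N \<noteq> 0" "\<And>k. N \<bullet> E k = 0" and dim: "DIM('v) = CARD('k) + 1" and w: "N \<bullet> w = 0"
  shows "w \<in> range (\<lambda>v :: real ^ 'k. \<Sum>k\<in>UNIV. v $ k *\<^sub>R E k)"
proof -
  define L where "L = (\<lambda>v :: real ^ 'k. \<Sum>k\<in>UNIV. v $ k *\<^sub>R E k)"
  have L: "linear L"
    by (rule linearI) (simp_all add: L_def scaleR_add_left sum.distrib scaleR_sum_right)
  have "inj L" unfolding linear_injective_0[OF L] unfolding L_def using indep by blast
  then have "dim (range L) = CARD('k)"
    using dim_image_eq[OF L, of UNIV] by simp
  moreover have "dim {w. N \<bullet> w = 0} = CARD('k)"
    using dim_hyperplane[OF N(1)] dim by simp
  moreover have "range L \<subseteq> {w. N \<bullet> w = 0}"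
    using N(2) by (auto simp: L_def inner_sum_right)
  ultimately have "range L = {w. N \<bullet> w = 0}"
    by (intro subspace_dim_equal subspace_hyperplane linear_subspace_image[OF L]) simp_all
  then show ?thesis using w unfolding L_def by blast
qed

section \<open>Parametrizations as immersions\<close>

lemma local_param_open: "local_param M U F \<Longrightarrow> open U"
  and local_param_smooth: "local_param M U F \<Longrightarrow> smooth_on F U"
  and local_param_in: "local_param M U F \<Longrightarrow> u \<in> U \<Longrightarrow> F u \<in> M"
  by (auto simp: local_param_def openin_subtopology)

lemma local_param_differentiable: "local_param M U F \<Longrightarrow> u \<in> U \<Longrightarrow> F differentiable (at u)"
  by (rule Ck_on_Suc_differentiable[OF smooth_on_imp_Ck[OF local_param_smooth]])

lemma local_param_indep:
  assumes "local_param M U F" "u \<in> U" "(\<Sum>i\<in>UNIV. v $ i *\<^sub>R partial i F u) = 0"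
  shows "v = 0"
proof -
  note d = local_param_differentiable[OF assms(1,2)]
  have "inj (frechet_derivative F (at u))" using assms by (simp add: local_param_def)
  moreover have "frechet_derivative F (at u) v = 0"
    using assms(3) by (simp add: differential_eq_sum_partial[OF d])
  ultimately show ?thesis
    using linear_injective_0[OF linear_frechet_derivative[OF d]] by blast
qed

text \<open>Positivity on the ambient space passes to the coefficient matrix because a nonzero
  \<open>v\<close> is sent to a nonzero tangent vector by the differential of
  \<open>F\<close>.\<close>

lemma riemannian_manifoldI:
  fixes M :: "'v::euclidean_space set"
  assumes M: "submanifold TYPE('k::finite) M" and bil: "\<And>p. bilinear (g p)"
    and sym: "\<And>p x y. g p x y = g p y x" and pos: "\<And>p x. x \<noteq> 0 \<Longrightarrow> g p x x > 0"
    and C2: "\<And>U (F :: real ^ 'k \<Rightarrow> 'v) i j. local_param M U F \<Longrightarrow>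
        Ck_on 2 (\<lambda>u. metric_coeffs g F u $ i $ j) U"
  shows "riemannian_manifold TYPE('k) M g"
proof -
  have "v \<bullet> (metric_coeffs g F u *v v) > 0"
    if F: "local_param M U F" "u \<in> U" and "v \<noteq> 0" for U and F :: "real ^ 'k \<Rightarrow> 'v" and u v
  proof -
    let ?w = "\<Sum>i\<in>UNIV. v $ i *\<^sub>R partial i F u"
    have "g (F u) ?w ?w = (\<Sum>i\<in>UNIV. \<Sum>j\<in>UNIV. v $ i * (v $ j * g (F u) (partial i F u) (partial j F u)))"
      by (simp add: bilinear_sum[OF bil] sum.cartesian_product bilinear_lmul[OF bil]
          bilinear_rmul[OF bil] mult.left_commute)
    also have "\<dots> = v \<bullet> (metric_coeffs g F u *v v)"
      by (simp add: metric_coeffs_def inner_vec_def matrix_vector_mult_def sum_distrib_left mult_ac)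
    finally show ?thesis using pos[of ?w "F u"] local_param_indep[OF F] \<open>v \<noteq> 0\<close> by force
  qed
  moreover have "transpose (metric_coeffs g F u) = metric_coeffs g F u" for F :: "real ^ 'k \<Rightarrow> 'v" and u
    using sym by (simp add: transpose_def metric_coeffs_def vec_eq_iff)
  ultimately show ?thesis
    using M bil C2 by (simp add: riemannian_manifold_def)
qed

section \<open>The induced and the warped metric\<close>

lemma metric_coeffs_induced:
  "metric_coeffs induced_metric F u $ i $ j = partial i F u \<bullet> partial j F u"
  by (simp add: metric_coeffs_def induced_metric_def)

lemma metric_coeffs_warped:
  assumes "F differentiable (at u)"
  shows "metric_coeffs (warped_metric H induced_metric) F u $ i $ j =
    partial i (\<lambda>u. fst (F u)) u * partial j (\<lambda>u. fst (F u)) u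
    + H (fst (F u)) * (partial i (\<lambda>u. snd (F u)) u \<bullet> partial j (\<lambda>u. snd (F u)) u)"
  using assms
  by (simp add: metric_coeffs_def warped_metric_def induced_metric_def
      partial_bounded_linear[OF bounded_linear_fst] partial_bounded_linear[OF bounded_linear_snd])

lemma local_param_Ck_partial: "local_param M U F \<Longrightarrow> Ck_on k (partial i F) U"
  by (rule Ck_on_partial[OF smooth_on_imp_Ck[OF local_param_smooth]])

lemma local_param_Ck_fst_snd:
  assumes "local_param M U F"
  shows "Ck_on k (\<lambda>u. fst (F u)) U" "Ck_on k (\<lambda>u. snd (F u)) U"
  using smooth_on_imp_Ck[OF local_param_smooth[OF assms]] local_param_open[OF assms]
  by (simp_all add: Ck_on_bounded_linear bounded_linear_fst bounded_linear_snd)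

lemma riemannian_manifold_induced:
  assumes "submanifold TYPE('k::finite) M"
  shows "riemannian_manifold TYPE('k) M induced_metric"
proof (rule riemannian_manifoldI[OF assms])
  show "bilinear (induced_metric p)" for p :: 'a
    unfolding induced_metric_def[abs_def] by (simp add: bilinear_conv_bounded_bilinear bounded_bilinear_inner)
  show "Ck_on 2 (\<lambda>u. metric_coeffs induced_metric F u $ i $ j) U"
    if "local_param M U F" for U and F :: "real ^ 'k \<Rightarrow> 'a" and i j
    unfolding metric_coeffs_induced
    by (intro Ck_on_inner local_param_Ck_partial[OF that] local_param_open[OF that])
qed (simp_all add: induced_metric_def inner_commute)

lemma riemannian_manifold_warped:
  assumes M: "submanifold TYPE('k::finite) M" and H: "Ck_on 2 H UNIV" "\<And>t. H t > 0"
  shows "riemannian_manifold TYPE('k) M (warped_metric H induced_metric)"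
proof (rule riemannian_manifoldI[OF M])
  show "bilinear (warped_metric H induced_metric p)" for p :: "real \<times> 'a"
    by (auto simp: bilinear_def warped_metric_def induced_metric_def inner_simps algebra_simps intro!: linearI)
  show "0 < warped_metric H induced_metric p x x" if "x \<noteq> 0" for p x :: "real \<times> 'a"
  proof (cases "snd x = 0")
    case True
    then have "fst x \<noteq> 0" using that by (auto simp: prod_eq_iff)
    then have "0 < fst x * fst x" using not_real_square_gt_zero by blast
    with True show ?thesis
      by (simp add: warped_metric_def induced_metric_def)
  next
    case False
    then have "0 < H (fst p) * (snd x \<bullet> snd x)" using H(2) by simp
    then show ?thesis by (simp add: warped_metric_def induced_metric_def add_nonneg_pos)
  qed
  show "Ck_on 2 (\<lambda>u. metric_coeffs (warped_metric H induced_metric) F u $ i $ j) U"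
    if F: "local_param M U F" for U and F :: "real ^ 'k \<Rightarrow> real \<times> 'a" and i j
  proof (rule Ck_on_cong[OF local_param_open[OF F]
        metric_coeffs_warped[OF local_param_differentiable[OF F], symmetric]])
    note C = local_param_Ck_fst_snd[OF F]
    show "Ck_on 2 (\<lambda>u. partial i (\<lambda>u. fst (F u)) u * partial j (\<lambda>u. fst (F u)) u
        + H (fst (F u)) * (partial i (\<lambda>u. snd (F u)) u \<bullet> partial j (\<lambda>u. snd (F u)) u)) U"
      by (intro Ck_on_add Ck_on_mult Ck_on_inner Ck_on_partial C local_param_open[OF F]
          Ck_on_compose_real[OF _ H(1)])
  qed
qed (simp add: warped_metric_def induced_metric_def inner_commute mult.commute)

text \<open>The differential of \<open>F\<close> is injective because of the differentiable left inverse \<open>G\<close>.\<close>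

lemma local_paramI:
  fixes F :: "real ^ 'k::finite \<Rightarrow> 'v::euclidean_space"
  assumes F: "smooth_on F UNIV" and GF: "\<And>u. G (F u) = u" and W: "open W"
    and FM: "\<And>u. F u \<in> M \<inter> W" and FG: "\<And>x. x \<in> M \<inter> W \<Longrightarrow> F (G x) = x"
    and G: "\<And>x. x \<in> W \<Longrightarrow> G differentiable (at x)"
  shows "local_param M UNIV F" "range F = M \<inter> W"
proof -
  show range: "range F = M \<inter> W"
    using FM FG by (metis (no_types, lifting) image_subset_iff rangeI subsetI subset_antisym)
  have d: "F differentiable (at u)" for u
    by (rule Ck_on_Suc_differentiable[OF smooth_on_imp_Ck[OF F] UNIV_I])
  have "inj (frechet_derivative F (at u))" for u
  proof (rule inj_on_inverseI)
    fix v
    have "((\<lambda>u. u) has_derivative frechet_derivative G (at (F u)) \<circ> frechet_derivative F (at u)) (at u)"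
      using diff_chain_at[OF has_derivative_frechet[OF d] has_derivative_frechet[OF G]] FM
      by (simp add: o_def GF)
    from has_derivative_unique[OF this has_derivative_ident]
    show "frechet_derivative G (at (F u)) (frechet_derivative F (at u) v) = v"
      by (simp add: fun_eq_iff)
  qed
  moreover have "homeomorphism UNIV (range F) F G"
  proof (rule homeomorphismI)
    show "continuous_on UNIV F" "continuous_on (range F) G"
      using d G FM by (auto intro!: continuous_at_imp_continuous_on differentiable_imp_continuous_within)
  qed (auto simp: GF)
  moreover have "openin (top_of_set M) (range F)"
    unfolding range using W by auto
  ultimately show "local_param M UNIV F"
    using F unfolding local_param_def by auto
qed

text \<open>Central projection of the affine hyperplane \<open>q + q\<^sup>\<bottom>\<close> to the sphere, and its inverse.\<close>

definition central :: "real \<Rightarrow> 'w::euclidean_space \<Rightarrow> 'w" where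
  "central r y = (r * inverse (sqrt (y \<bullet> y))) *\<^sub>R y"

definition uncentral :: "real \<Rightarrow> 'w::euclidean_space \<Rightarrow> 'w \<Rightarrow> 'w" where
  "uncentral r q x = (r\<^sup>2 / (q \<bullet> x)) *\<^sub>R x"

context
  fixes r :: real and q :: "'w::euclidean_space"
  assumes r: "r > 0" and q: "q \<bullet> q = r\<^sup>2"
begin

text \<open>The affine hyperplane misses the origin, so the denominators in \<open>central\<close>
  and \<open>uncentral\<close> do not vanish on it.\<close>

lemma affine_point:
  assumes "q \<bullet> y = 0"
  shows "q \<bullet> (y + q) = r\<^sup>2" "y + q \<noteq> 0"
proof -
  show "q \<bullet> (y + q) = r\<^sup>2" using assms q by (simp add: inner_add_right)
  then show "y + q \<noteq> 0" using r by auto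
qed

lemma central_sphere:
  assumes "q \<bullet> y = 0"
  shows "central r (y + q) \<in> sphere 0 r" "q \<bullet> central r (y + q) > 0"
proof -
  have "norm (y + q) > 0" using affine_point[OF assms] by simp
  then show "central r (y + q) \<in> sphere 0 r" "q \<bullet> central r (y + q) > 0"
    using r affine_point(1)[OF assms] by (simp_all add: central_def norm_eq_sqrt_inner[symmetric])
qed

text \<open>\<open>uncentral r q\<close> is homogeneous of degree zero, so the scaling factor
  introduced by \<open>central\<close> drops out.\<close>

lemma uncentral_central:
  assumes "q \<bullet> y = 0"
  shows "uncentral r q (central r (y + q)) = y + q"
proof -
  have "uncentral r q (c *\<^sub>R z) = uncentral r q z" if "c \<noteq> 0" for c and z :: 'w
    using that by (simp add: uncentral_def)
  then have "uncentral r q (central r (y + q)) = uncentral r q (y + q)"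
    unfolding central_def using affine_point(2)[OF assms] r by simp
  then show ?thesis using affine_point(1)[OF assms] r by (simp add: uncentral_def)
qed

lemma inner_uncentral: "q \<bullet> x > 0 \<Longrightarrow> q \<bullet> uncentral r q x = r\<^sup>2"
  by (simp add: uncentral_def)

lemma central_uncentral:
  assumes "x \<in> sphere 0 r" "q \<bullet> x > 0"
  shows "central r (uncentral r q x) = x"
proof -
  have "sqrt (uncentral r q x \<bullet> uncentral r q x) = r\<^sup>2 / (q \<bullet> x) * r"
    unfolding norm_eq_sqrt_inner[symmetric] using assms by (simp add: uncentral_def)
  then show ?thesis using assms r by (simp add: central_def uncentral_def power2_eq_square)
qed

lemma uncentral_differentiable:
  "q \<bullet> x > 0 \<Longrightarrow> uncentral r q differentiable (at x)"
  unfolding uncentral_def[abs_def] by simp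

lemma Ck_on_central:
  assumes "linear L" "\<And>u. q \<bullet> L u = 0"
  shows "Ck_on k (\<lambda>u. central r (L u + q)) UNIV"
proof -
  have A: "Ck_on k (\<lambda>u. L u + q) UNIV"
    using assms(1)
    by (intro Ck_on_add Ck_on_const Ck_on_bounded_linear[OF open_UNIV _ Ck_on_id])
      (simp_all add: linear_conv_bounded_linear)
  have pos: "0 < (L u + q) \<bullet> (L u + q)" for u
    using affine_point(2)[OF assms(2)] by simp
  show ?thesis unfolding central_def
    by (intro Ck_on_scaleR Ck_on_mult Ck_on_const Ck_on_inverse_sqrt Ck_on_inner A open_UNIV pos)
qed

end

text \<open>Around \<open>q\<close> the open hemisphere centred at \<open>q\<close> is the image of
  a chart: a linear identification of the coordinate space with the complement of \<open>q\<close>,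
  followed by central projection.\<close>

lemma submanifold_sphere:
  assumes dim: "CARD('n::finite) = CARD('m::finite) + 1" and r: "r > 0"
  shows "submanifold TYPE('m) (sphere (0 :: real ^ 'n) r)"
  unfolding submanifold_def
proof
  fix q :: "real ^ 'n" assume "q \<in> sphere 0 r"
  then have q: "q \<bullet> q = r\<^sup>2" by (simp add: power2_norm_eq_inner[symmetric])
  have "q \<noteq> 0" using q r by auto
  then have "dim (UNIV :: (real ^ 'm) set) = dim {x. q \<bullet> x = 0}"
    using dim by (simp add: dim_hyperplane)
  then obtain L :: "real ^ 'm \<Rightarrow> real ^ 'n" and L' where L: "linear L" "linear L'"
      "range L = {x. q \<bullet> x = 0}" and L'L: "\<And>x. L' (L x) = x"
      and LL': "\<And>x. q \<bullet> x = 0 \<Longrightarrow> L (L' x) = x"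
    by (rule isometries_subspaces[OF subspace_UNIV subspace_hyperplane]) auto
  have qL: "q \<bullet> L u = 0" for u using L(3) by blast
  define F where "F u = central r (L u + q)" for u
  define G where "G x = L' (uncentral r q x - q)" for x
  let ?W = "{x. q \<bullet> x > 0}"
  have smooth: "smooth_on F UNIV"
    unfolding smooth_on_def F_def using Ck_on_central[OF r q L(1) qL] by simp
  have GF: "G (F u) = u" for u
    by (simp add: F_def G_def uncentral_central[OF r q qL] L'L)
  have FM: "F u \<in> sphere 0 r \<inter> ?W" for u
    using central_sphere[OF r q qL] by (simp add: F_def)
  have FG: "F (G x) = x" if "x \<in> sphere 0 r \<inter> ?W" for x
  proof -
    have "q \<bullet> (uncentral r q x - q) = 0"
      using that inner_uncentral[OF r q] by (simp add: inner_diff_right q)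
    then show ?thesis using that central_uncentral[OF r q] by (simp add: F_def G_def LL')
  qed
  have G: "G differentiable (at x)" if "x \<in> ?W" for x
  proof -
    have "(\<lambda>x. uncentral r q x - q) differentiable (at x)"
      using uncentral_differentiable[OF r q] that by simp
    then show ?thesis unfolding G_def
      by (rule differentiable_compose[OF linear_imp_differentiable[OF L(2)]])
  qed
  have W: "open ?W" by (rule open_halfspace_gt)
  have "local_param (sphere 0 r) UNIV F" "range F = sphere 0 r \<inter> ?W"
    by (rule local_paramI[OF smooth GF W FM FG G]; assumption)+
  moreover have "q \<in> sphere 0 r \<inter> ?W" using q r \<open>q \<in> sphere 0 r\<close> by simp
  ultimately show "\<exists>U (F :: real ^ 'm \<Rightarrow> real ^ 'n). local_param (sphere 0 r) U F \<and> q \<in> F ` U"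
    by metis
qed

text \<open>Here \<open>q\<close> also serves as the axis of the line, so that no identification of \<open>q\<^sup>\<bottom>\<close> with a
  coordinate space is needed.\<close>

lemma submanifold_line_times_sphere:
  assumes r: "r > 0"
  shows "submanifold TYPE('n::finite) (UNIV \<times> sphere (0 :: real ^ 'n) r :: (real \<times> (real ^ 'n)) set)"
    (is "submanifold _ ?M")
  unfolding submanifold_def
proof
  fix p :: "real \<times> (real ^ 'n)" assume p: "p \<in> ?M"
  define q where "q = snd p"
  have qs: "q \<in> sphere 0 r" using p by (auto simp: q_def)
  then have q: "q \<bullet> q = r\<^sup>2" by (simp add: power2_norm_eq_inner[symmetric])
  \<comment> \<open>\<open>L\<close> is the orthogonal projection to the complement of
    \<open>q\<close>. The discarded component along \<open>q\<close>, divided by the length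
    \<open>r\<close> of \<open>q\<close>, becomes the coordinate on the line.\<close>
  define L where "L u = u - ((q \<bullet> u) / r\<^sup>2) *\<^sub>R q" for u
  have L: "linear L"
    by (rule linearI) (simp_all add: L_def inner_simps algebra_simps add_divide_distrib)
  have qL: "q \<bullet> L u = 0" for u using r by (simp add: L_def inner_simps q)
  define F where "F u = ((q \<bullet> u) / r, central r (L u + q))" for u
  define G where "G x = (fst x / r) *\<^sub>R q + (uncentral r q (snd x) - q)" for x
  let ?W = "UNIV \<times> {x. q \<bullet> x > 0} :: (real \<times> (real ^ 'n)) set"
  have "Ck_on k (\<lambda>u. (q \<bullet> u) / r) UNIV" for k
    unfolding divide_inverse by (intro Ck_on_mult Ck_on_inner Ck_on_const Ck_on_id open_UNIV)
  then have smooth: "smooth_on F UNIV"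
    unfolding smooth_on_def F_def using Ck_on_central[OF r q L qL] by (intro allI Ck_on_Pair) simp_all
  have GF: "G (F u) = u" for u
    by (simp add: F_def G_def uncentral_central[OF r q qL]) (simp add: L_def power2_eq_square)
  have FM: "F u \<in> ?M \<inter> ?W" for u
    using central_sphere[OF r q qL] by (simp add: F_def)
  have FG: "F (G x) = x" if "x \<in> ?M \<inter> ?W" for x
  proof -
    have 1: "q \<bullet> uncentral r q (snd x) = r\<^sup>2"
      using that inner_uncentral[OF r q] by auto
    then have 2: "q \<bullet> G x = r * fst x"
      using r by (simp add: G_def inner_simps q power2_eq_square)
    then have "L (G x) + q = uncentral r q (snd x)"
      using r unfolding L_def by (simp add: G_def power2_eq_square)
    then show ?thesis using 2 r that central_uncentral[OF r q, of "snd x"]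
      by (auto simp: F_def prod_eq_iff)
  qed
  have G: "G differentiable (at x)" if "x \<in> ?W" for x
  proof -
    have "(\<lambda>x. uncentral r q (snd x)) differentiable (at x)"
      using that by (intro differentiable_compose[of "uncentral r q" snd,
          OF uncentral_differentiable[OF r q] bounded_linear_imp_differentiable[OF bounded_linear_snd]]) auto
    moreover have "fst differentiable (at x)"
      by (intro bounded_linear_imp_differentiable bounded_linear_fst)
    ultimately show ?thesis unfolding G_def divide_inverse
      by (intro differentiable_add differentiable_diff differentiable_scaleR differentiable_mult
          differentiable_const)
  qed
  have W: "open ?W" by (intro open_Times open_UNIV open_halfspace_gt)
  have "local_param ?M UNIV F" "range F = ?M \<inter> ?W"
    by (rule local_paramI[OF smooth GF W FM FG G]; assumption)+
  moreover have "p \<in> ?M \<inter> ?W" using q r p by (auto simp: q_def)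
  ultimately show "\<exists>U (F :: real ^ 'n \<Rightarrow> real \<times> (real ^ 'n)). local_param ?M U F \<and> p \<in> F ` U"
    by metis
qed

section \<open>Curvature of the sphere and of the warped product\<close>

lemma constant_ricci_sphere:
  assumes dim: "CARD('n::finite) = CARD('m::finite) + 1" and r: "r > 0"
  shows "constant_ricci TYPE('m) (sphere (0 :: real ^ 'n) r) induced_metric ((real CARD('m) - 1) / r\<^sup>2)"
proof -
  have "ricci (metric_coeffs induced_metric F) i j u =
      (real CARD('m) - 1) / r\<^sup>2 * metric_coeffs induced_metric F u $ i $ j"
    if F: "local_param (sphere (0 :: real ^ 'n) r) U F" and u: "u \<in> U"
    for U and F :: "real ^ 'm \<Rightarrow> real ^ 'n" and u i j
  proof -
    have Fs: "F u \<bullet> F u = r\<^sup>2" if "u \<in> U" for u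
      using local_param_in[OF F that] by (simp add: power2_norm_eq_inner[symmetric])
    interpret w: warped U "\<lambda>_. 0" F "1 / r\<^sup>2" "\<lambda>_. 1" "\<lambda>_. 0" "\<lambda>_. 0"
      using r Fs by unfold_locales
        (auto intro: local_param_open[OF F] smooth_on_imp_Ck[OF local_param_smooth[OF F]])
    have ind: "v = 0" if "u \<in> U" "(\<Sum>i\<in>UNIV. v $ i *\<^sub>R partial i F u) = 0" for u v
      using local_param_indep[OF F that] .
    interpret wf: warped_frame U "\<lambda>_. 0" F "1 / r\<^sup>2" "\<lambda>_. 1" "\<lambda>_. 0" "\<lambda>_. 0"
      "metric_coeffs induced_metric F"
    proof
      show "v = 0" if "u \<in> U" "(\<Sum>i\<in>UNIV. v $ i *\<^sub>R w.E i u) = 0" for u v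
        using ind[OF that(1)] arg_cong[OF that(2), of snd] by (simp add: w.E_def snd_sum)
      \<comment> \<open>All line components are zero here, so the dimension count takes place in the
        second factor, with normal \<open>F u\<close>.\<close>
      show "w.S i j u \<in> range (\<lambda>v. \<Sum>k\<in>UNIV. v $ k *\<^sub>R w.E k u)" if u: "u \<in> U" for u i j
      proof -
        have "F u \<noteq> 0" using Fs[OF u] r by auto
        then have "snd (w.S i j u) \<in> range (\<lambda>v. \<Sum>k\<in>UNIV. v $ k *\<^sub>R partial k F u)"
          using ind[OF u] w.X_orthogonal[OF u] w.S_orthogonal[OF u] dim
          by (intro frame_spans_hyperplane[of _ "F u"]) simp_all
        then obtain v where "snd (w.S i j u) = (\<Sum>k\<in>UNIV. v $ k *\<^sub>R partial k F u)" by blast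
        then have "w.S i j u = (\<Sum>k\<in>UNIV. v $ k *\<^sub>R w.E k u)"
          by (simp add: prod_eq_iff fst_sum snd_sum w.E_def w.S_def)
        then show ?thesis by blast
      qed
    qed (simp_all add: metric_coeffs_induced)
    show ?thesis
      using wf.ricci_round[OF u] by (simp add: metric_coeffs_induced w.h_def)
  qed
  then show ?thesis
    using riemannian_manifold_induced[OF submanifold_sphere[OF dim r]]
    by (simp add: constant_ricci_def)
qed

text \<open>The equations for \<open>\<psi>1\<close> and \<open>\<psi>2\<close> are those satisfied
  by the first two derivatives of \<open>\<psi> = exp (\<phi> / N)\<close>.\<close>

lemma (in warped_frame) ric1_warped:
  assumes u: "u \<in> U" and e: "(1, 0) \<in> range (\<lambda>v. \<Sum>k\<in>UNIV. v $ k *\<^sub>R E k u)"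
    and \<phi>: "\<And>t. (\<phi> has_real_derivative \<phi>1 t) (at t)" "\<And>t. (\<phi>1 has_real_derivative \<phi>2 t) (at t)"
    and N: "real CARD('a) - 1 = N" "N > 0"
    and \<psi>1_eq: "\<psi>1 (T u) = \<psi> (T u) * (\<phi>1 (T u) / N)"
    and \<psi>2_eq: "\<psi>2 (T u) = \<psi> (T u) * (\<phi>2 (T u) / N + (\<phi>1 (T u) / N)\<^sup>2)"
  shows "ric1 G (\<lambda>u. \<phi> (T u)) i j u =
    ((N - 1) * \<kappa> - (\<psi> (T u))\<^sup>2 * \<phi>2 (T u) / N) * h i j u"
proof -
  note d = differentiables[OF u]
  have p1: "partial k (\<lambda>u. \<phi> (T u)) x = \<phi>1 (T x) * partial k T x" if "x \<in> U" for k x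
    using that by (simp add: partial_compose_real[OF \<phi>(1)] differentiables)
  have "partial i (partial j (\<lambda>u. \<phi> (T u))) u = partial i (\<lambda>u. \<phi>1 (T u) * partial j T u) u"
  proof (rule partial_cong[OF U u, symmetric])
    show "(\<lambda>u. \<phi>1 (T u) * partial j T u) differentiable (at u)"
      by (intro differentiable_mult differentiable_compose_real[OF \<phi>(2)] d)
  qed (simp add: p1)
  also have "\<dots> = \<phi>1 (T u) * partial i (partial j T) u + \<phi>2 (T u) * partial i T u * partial j T u"
    by (simp add: partial_mult differentiable_compose_real[OF \<phi>(2)] partial_compose_real[OF \<phi>(2)] d)
  finally have p2: "partial i (partial j (\<lambda>u. \<phi> (T u))) u
      = \<phi>1 (T u) * partial i (partial j T) u + \<phi>2 (T u) * partial i T u * partial j T u" .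
  have "(\<Sum>k\<in>UNIV. christoffel G k i j u * partial k (\<lambda>u. \<phi> (T u)) u) =
      \<phi>1 (T u) * (partial j (partial i T) u - \<psi> (T u) * \<psi>1 (T u) * h i j u)"
    unfolding christoffel_T[OF u, symmetric] by (simp add: p1 u sum_distrib_left mult_ac)
  then have hess: "hess G (\<lambda>u. \<phi> (T u)) i j u = \<phi>2 (T u) * partial i T u * partial j T u
      + \<phi>1 (T u) * \<psi> (T u) * \<psi>1 (T u) * h i j u"
    by (simp add: hess_def p2 partial_commute[OF U u Ck_partials(1), of i j]
        algebra_simps)
  have N2: "real CARD('a) - 2 = N - 1" using N by simp
  have p: "\<psi> (T u) \<noteq> 0" using \<psi>_pos[of "T u"] by simp
  \<comment> \<open>In the coefficient of \<open>h i j u\<close> the squares of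
    \<open>\<phi>1\<close> have total weight \<open>- (N - 1) - 1 + N = 0\<close>, from the
    curvature \<open>\<kappa> - \<psi>1^2\<close>, from \<open>\<psi> * \<psi>2\<close> and from the
    Hessian.\<close>
  show ?thesis
    unfolding ric1_def ricci_warped[OF u e] hess p1[OF u] N(1) N2 \<psi>1_eq \<psi>2_eq
    using N(2) p by (simp add: field_simps power2_eq_square)
qed

text \<open>By \<open>ric1_warped\<close> the quadratic form at \<open>v\<close> is a scalar times
  the squared norm of the spherical part of the tangent vector; the second condition on
  \<open>\<kappa>\<close> says that this scalar is nonnegative.\<close>

lemma CD01_warped:
  fixes \<phi> \<phi>1 \<phi>2 :: "real \<Rightarrow> real" and \<kappa> N :: real
  assumes N: "real CARD('n::finite) - 1 = N" "N > 1"
    and \<kappa>: "\<kappa> > 0" "\<And>t. exp (2 * \<phi> t / N) * \<phi>2 t / N \<le> (N - 1) * \<kappa>"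
    and Ck: "Ck_on 2 \<phi> UNIV"
    and \<phi>: "\<And>t. (\<phi> has_real_derivative \<phi>1 t) (at t)" "\<And>t. (\<phi>1 has_real_derivative \<phi>2 t) (at t)"
  shows "CD01 TYPE('n) (UNIV \<times> sphere (0 :: real ^ 'n) (1 / sqrt \<kappa>))
      (warped_metric (\<lambda>t. exp (2 * \<phi> t / N)) induced_metric) (\<lambda>p. \<phi> (fst p))"
proof -
  let ?M = "UNIV \<times> sphere (0 :: real ^ 'n) (1 / sqrt \<kappa>) :: (real \<times> (real ^ 'n)) set"
  let ?g = "warped_metric (\<lambda>t. exp (2 * \<phi> t / N)) induced_metric :: real \<times> (real ^ 'n) \<Rightarrow> _"
  define \<psi> \<psi>1 \<psi>2 where "\<psi> t = exp (\<phi> t / N)" and "\<psi>1 t = \<psi> t * (\<phi>1 t / N)"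
    and "\<psi>2 t = \<psi> t * (\<phi>2 t / N + (\<phi>1 t / N)\<^sup>2)" for t
  have d\<psi>: "(\<psi> has_real_derivative \<psi>1 t) (at t)" for t
    unfolding \<psi>_def[abs_def] \<psi>1_def using N(2) by (auto intro!: derivative_eq_intros \<phi> simp: \<psi>_def)
  have d\<psi>1: "(\<psi>1 has_real_derivative \<psi>2 t) (at t)" for t
  proof -
    have "((\<lambda>t. \<psi> t * (\<phi>1 t / N)) has_real_derivative \<psi>1 t * (\<phi>1 t / N) + \<phi>2 t / N * \<psi> t) (at t)"
      by (rule DERIV_mult[OF d\<psi> DERIV_cdivide[OF \<phi>(2)]])
    moreover have "\<psi>1 t * (\<phi>1 t / N) + \<phi>2 t / N * \<psi> t = \<psi>2 t"
      by (simp add: \<psi>1_def \<psi>2_def algebra_simps power2_eq_square)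
    ultimately show ?thesis unfolding \<psi>1_def[abs_def] by simp
  qed
  have \<psi>_sq: "(\<psi> t)\<^sup>2 = exp (2 * \<phi> t / N)" for t
    by (simp add: \<psi>_def power2_eq_square mult_exp_exp)
  have Ck_exp: "Ck_on 2 (\<lambda>t. exp (2 * \<phi> t / N)) UNIV"
    unfolding divide_inverse
    by (intro Ck_on_compose_real[OF open_UNIV Ck_on_exp] Ck_on_mult Ck_on_const Ck open_UNIV)
  have riem: "riemannian_manifold TYPE('n) ?M ?g"
  proof (rule riemannian_manifold_warped[OF submanifold_line_times_sphere Ck_exp])
    show "0 < 1 / sqrt \<kappa>" using \<kappa>(1) by simp
  qed simp
  have "Ck_on 2 ((\<lambda>p. \<phi> (fst p)) \<circ> F) U \<and> (\<forall>u\<in>U. \<forall>v. 0 \<le> (\<Sum>i\<in>UNIV. \<Sum>j\<in>UNIV.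
      ric1 (metric_coeffs ?g F) ((\<lambda>p. \<phi> (fst p)) \<circ> F) i j u * v $ i * v $ j))"
    if F: "local_param ?M U F" for U and F :: "real ^ 'n \<Rightarrow> real \<times> (real ^ 'n)"
  proof (intro conjI ballI allI)
    let ?T = "\<lambda>u. fst (F u)" and ?X = "\<lambda>u. snd (F u)"
    note C = local_param_Ck_fst_snd[OF F] and dF = local_param_differentiable[OF F]
    show "Ck_on 2 ((\<lambda>p. \<phi> (fst p)) \<circ> F) U"
      unfolding o_def by (rule Ck_on_compose_real[OF local_param_open[OF F] Ck C(1)])
    have Xs: "\<kappa> * (?X u \<bullet> ?X u) = 1" if "u \<in> U" for u
    proof -
      have "norm (?X u) = 1 / sqrt \<kappa>" using local_param_in[OF F that] by auto
      then have "?X u \<bullet> ?X u = (1 / sqrt \<kappa>)\<^sup>2" by (simp add: power2_norm_eq_inner[symmetric])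
      then show ?thesis using \<kappa>(1) by (simp add: power_divide)
    qed
    interpret w: warped U ?T ?X \<kappa> \<psi> \<psi>1 \<psi>2
      by unfold_locales (fact local_param_open[OF F] C Xs d\<psi> d\<psi>1 | simp add: \<psi>_def)+
    have ind: "v = 0" if u: "u \<in> U" and v: "(\<Sum>i\<in>UNIV. v $ i *\<^sub>R w.E i u) = 0" for u v
    proof (rule local_param_indep[OF F u])
      have "(\<Sum>i\<in>UNIV. v $ i * partial i ?T u) = 0"
        using arg_cong[OF v, of fst] by (simp add: w.E_def fst_sum)
      moreover have "\<psi> (?T u) *\<^sub>R (\<Sum>i\<in>UNIV. v $ i *\<^sub>R partial i ?X u) = 0"
        using arg_cong[OF v, of snd] by (simp add: w.E_def snd_sum scaleR_sum_right mult.commute)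
      moreover have "\<psi> (?T u) \<noteq> 0" by (simp add: \<psi>_def)
      ultimately show "(\<Sum>i\<in>UNIV. v $ i *\<^sub>R partial i F u) = 0"
        by (simp add: prod_eq_iff fst_sum snd_sum partial_bounded_linear[OF bounded_linear_fst dF[OF u]]
            partial_bounded_linear[OF bounded_linear_snd dF[OF u]])
    qed
    \<comment> \<open>Here the frame has codimension one in the product, with normal
      \<open>(0, snd (F u))\<close>. This covers both the vectors \<open>w.S i j u\<close> and the
      unit vector \<open>(1, 0)\<close> of the line.\<close>
    have tangent: "y \<in> range (\<lambda>v. \<Sum>k\<in>UNIV. v $ k *\<^sub>R w.E k u)"
      if u: "u \<in> U" and y: "?X u \<bullet> snd y = 0" for u y
    proof (rule frame_spans_hyperplane[of _ "(0, ?X u)"])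
      show "(0, ?X u) \<noteq> 0" using Xs[OF u] by (auto simp: zero_prod_def)
    qed (use ind[OF u] w.X_orthogonal[OF u] y in \<open>simp_all add: w.E_def inner_prod_def\<close>)
    interpret wf: warped_frame U ?T ?X \<kappa> \<psi> \<psi>1 \<psi>2 "metric_coeffs ?g F"
    proof
      show "metric_coeffs ?g F u $ i $ j = partial i ?T u * partial j ?T u
          + (\<psi> (?T u))\<^sup>2 * (partial i ?X u \<bullet> partial j ?X u)" if "u \<in> U" for u i j
        by (simp add: metric_coeffs_warped[OF dF[OF that]] \<psi>_sq)
      show "w.S i j u \<in> range (\<lambda>v. \<Sum>k\<in>UNIV. v $ k *\<^sub>R w.E k u)" if "u \<in> U" for u i j
        by (intro tangent w.S_orthogonal that)
    qed (rule ind)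
    fix u v assume u: "u \<in> U"
    let ?A = "(N - 1) * \<kappa> - (\<psi> (?T u))\<^sup>2 * \<phi>2 (?T u) / N"
    have ric: "ric1 (metric_coeffs ?g F) ((\<lambda>p. \<phi> (fst p)) \<circ> F) i j u = ?A * w.h i j u" for i j
      unfolding o_def using N
      by (intro wf.ric1_warped[OF u tangent[OF u] \<phi>]) (simp_all add: \<psi>1_def \<psi>2_def)
    have "(\<Sum>i\<in>UNIV. \<Sum>j\<in>UNIV. ric1 (metric_coeffs ?g F) ((\<lambda>p. \<phi> (fst p)) \<circ> F) i j u * v $ i * v $ j)
      = ?A * ((\<Sum>i\<in>UNIV. v $ i *\<^sub>R partial i ?X u) \<bullet> (\<Sum>j\<in>UNIV. v $ j *\<^sub>R partial j ?X u))"
      unfolding ric w.h_def inner_sum_left inner_sum_right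
      by (simp add: sum_distrib_left mult_ac inner_commute)
    moreover have "?A \<ge> 0" using \<kappa>(2)[of "?T u"] by (simp add: \<psi>_sq)
    ultimately show "0 \<le> (\<Sum>i\<in>UNIV. \<Sum>j\<in>UNIV.
        ric1 (metric_coeffs ?g F) ((\<lambda>p. \<phi> (fst p)) \<circ> F) i j u * v $ i * v $ j)"
      by simp
  qed
  then show ?thesis using riem by (simp add: CD01_def)
qed

text \<open>Translates between the iterated \<open>frechet_derivative\<close> in
  \<open>Ck_on\<close> and the \<open>deriv\<close> of the bounds in the theorem.\<close>

lemma Ck_on_2_has_real_derivatives:
  assumes "Ck_on 2 \<phi> (UNIV :: real set)"
  shows "(\<phi> has_real_derivative deriv \<phi> t) (at t)"
    "(deriv \<phi> has_real_derivative deriv (deriv \<phi>) t) (at t)"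
proof -
  have *: "(f has_real_derivative deriv f t) (at t)" "frechet_derivative f (at t) 1 = deriv f t"
    if "f differentiable (at t)" for f :: "real \<Rightarrow> real" and t
  proof -
    show "(f has_real_derivative deriv f t) (at t)"
      using that by (simp add: DERIV_deriv_iff_real_differentiable)
    then have "(*) (deriv f t) = frechet_derivative f (at t)"
      unfolding has_field_derivative_def by (rule frechet_derivative_at)
    from fun_cong[OF this, of 1] show "frechet_derivative f (at t) 1 = deriv f t"
      by simp
  qed
  have d: "\<phi> differentiable (at t)" "(\<lambda>t. frechet_derivative \<phi> (at t) 1) differentiable (at t)" for t
    using assms by (simp_all add: numeral_2_eq_2)
  from d(1) show "(\<phi> has_real_derivative deriv \<phi> t) (at t)" by (rule *)
  have "(\<lambda>t. frechet_derivative \<phi> (at t) 1) = deriv \<phi>" using *(2) d by blast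
  with d show "(deriv \<phi> has_real_derivative deriv (deriv \<phi>) t) (at t)" by (intro *) metis
qed

theorem corollary2p4:
  fixes \<phi> :: "real \<Rightarrow> real" and n :: nat
  assumes "n \<ge> 3"
    and "CARD('n::finite) = n" and "CARD('m::finite) = n - 1"
    and "Ck_on 2 \<phi> UNIV"
    and "bounded (range \<phi>)"
    and "bounded (range (deriv \<phi>))"
    and "bounded (range (deriv (deriv \<phi>)))"
  shows "\<exists>lam>0. \<exists>r>0.
    constant_ricci TYPE('m) (sphere (0 :: real ^ 'n) r) induced_metric lam \<and>
    CD01 TYPE('n) (UNIV \<times> sphere (0 :: real ^ 'n) r)
      (warped_metric (\<lambda>t. exp (2 * \<phi> t / (real n - 1))) induced_metric)
      (\<lambda>p. \<phi> (fst p))"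
proof -
  define N where "N = real n - 1"
  have N: "N \<ge> 2" using assms(1) by (simp add: N_def)
  obtain K0 where K0: "\<bar>\<phi> t\<bar> \<le> K0" for t
    using assms(5) unfolding bounded_iff by auto
  obtain K where K: "\<bar>deriv (deriv \<phi>) t\<bar> \<le> K" for t
    using assms(7) unfolding bounded_iff by auto
  have K_pos: "K \<ge> 0" using K[of 0] by linarith
  \<comment> \<open>The product bounds
    \<open>exp (2 * \<phi> t / N) * deriv (deriv \<phi>) t\<close>; adding one keeps
    \<open>\<kappa>\<close> positive when \<open>K = 0\<close>. The radius will be
    \<open>1 / sqrt \<kappa>\<close>.\<close>
  define \<kappa> where "\<kappa> = exp (2 * K0 / N) * K + 1"
  have \<kappa>: "\<kappa> > 0" using K_pos by (simp add: \<kappa>_def add_nonneg_pos)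
  have "exp (2 * \<phi> t / N) * deriv (deriv \<phi>) t / N \<le> (N - 1) * \<kappa>" for t
  proof -
    have "exp (2 * \<phi> t / N) * deriv (deriv \<phi>) t / N \<le> exp (2 * \<phi> t / N) * K / N"
      using K[of t] N by (intro divide_right_mono mult_left_mono) (simp_all add: abs_le_iff)
    also have "\<dots> \<le> exp (2 * \<phi> t / N) * K / 1"
      using N K_pos by (intro divide_left_mono) simp_all
    also have "\<dots> \<le> exp (2 * K0 / N) * K"
      using K0[of t] N K_pos by (simp add: mult_right_mono divide_right_mono abs_le_iff)
    \<comment> \<open>The factor \<open>1\<close> is then raised to \<open>N - 1\<close>, which is
      at least one since \<open>n \<ge> 3\<close>.\<close>
    also have "\<dots> \<le> 1 * \<kappa>" by (simp add: \<kappa>_def)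
    also have "\<dots> \<le> (N - 1) * \<kappa>" using N \<kappa> by (intro mult_right_mono) simp_all
    finally show ?thesis .
  qed
  then have "CD01 TYPE('n) (UNIV \<times> sphere (0 :: real ^ 'n) (1 / sqrt \<kappa>))
      (warped_metric (\<lambda>t. exp (2 * \<phi> t / N)) induced_metric) (\<lambda>p. \<phi> (fst p))"
    using N assms(2)
    by (intro CD01_warped[OF _ _ \<kappa> _ assms(4) Ck_on_2_has_real_derivatives[OF assms(4)]])
      (simp_all add: N_def)
  moreover have "constant_ricci TYPE('m) (sphere (0 :: real ^ 'n) (1 / sqrt \<kappa>)) induced_metric
      ((real CARD('m) - 1) / (1 / sqrt \<kappa>)\<^sup>2)"
    using assms(1-3) \<kappa> by (intro constant_ricci_sphere) simp_all
  \<comment> \<open>The witness for \<open>lam\<close> equals \<open>(n - 2) * \<kappa>\<close>,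
    which is positive because \<open>n \<ge> 3\<close>.\<close>
  moreover have "(real CARD('m) - 1) / (1 / sqrt \<kappa>)\<^sup>2 > 0"
    using assms(1,3) \<kappa> by simp
  moreover have "1 / sqrt \<kappa> > 0" using \<kappa> by simp
  ultimately show ?thesis unfolding N_def by blast
qed

end
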